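(* For every $n\ge1$ there exists a maximal complementary set of Abelian subgroups of $\widetilde{\mathcal P}_n$ of dimension $m=n-1$, i.e. an indexed family $\{\tilde A_k\}_{k=1}^{2^n+1}$ of Abelian subgroups of $\widetilde{\mathcal P}_n$, each of dimension $n-1$, such that $\tilde A_k$ and $\tilde A_l$ are complementary for all $k\neq l$.
   Context: $\widetilde{\mathcal P}_n=\{\mathbb 1,X,Y,Z\}^{\otimes n}$ is the set of the $4^n$ Hermitian $n$-qubit Pauli operators on $\mathbb C^{2^n}$, and $\mathcal P_n$ is the Pauli group they generate (phases $\pm1,\pm i$). An Abelian subgroup $A$ of $\widetilde{\mathcal P}_n$ means a commutative subgroup $A<\mathcal P_n$ with $A\subset\pm\widetilde{\mathcal P}_n$ and $-\mathbb 1\notin A$; then $A\cong\mathbb Z_2^m$ for some $0\le m\le n$, called its dimension. Subgroups differing only by signs of elements are identified. Choosing independent generators $P_1,\dots,P_m$ of $A$, set $\Pi^A_x=\prod_{k=1}^m\frac{\mathbb 1+(-1)^{x_k}P_k}{2}$ and $p^A_\rho(x)=\mathrm{tr}[\Pi^A_x\rho]$ for $x\in\mathbb Z_2^m$ and $\rho$ a density operator on $\mathbb C^{2^n}$. The state $\rho$ is a state of maximal information in $A$ if $p^A_\rho(x)=\delta_{xx_0}$ for some $x_0$, and is unbiased in $A$ if $p^A_\rho(x)=2^{-m}$ for all $x$. Two Abelian subgroups $A,B$ are complementary if every state of maximal information in $A$ is unbiased in $B$ and every state of maximal information in $B$ is unbiased in $A$. *)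

theory Defs
  imports
    "HOL-Algebra.Algebra"
    "HOL-Algebra.Elementary_Groups"
    "HOL-Algebra.Product_Groups"
    "Jordan_Normal_Form.Matrix"
    "Jordan_Normal_Form.Schur_Decomposition"
begin

section \<open>Pauli operators and the Pauli group\<close>

definition kron :: "complex mat \<Rightarrow> complex mat \<Rightarrow> complex mat" where
  "kron A B = mat (dim_row A * dim_row B) (dim_col A * dim_col B)
     (\<lambda>(i, j). A $$ (i div dim_row B, j div dim_col B) * B $$ (i mod dim_row B, j mod dim_col B))"

definition pauli_X :: "complex mat" where
  "pauli_X = mat_of_rows_list 2 [[0, 1], [1, 0]]"

definition pauli_Y :: "complex mat" where
  "pauli_Y = mat_of_rows_list 2 [[0, - \<i>], [\<i>, 0]]"

definition pauli_Z :: "complex mat" where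
  "pauli_Z = mat_of_rows_list 2 [[1, 0], [0, - 1]]"

fun pauli_ops :: "nat \<Rightarrow> complex mat set" where
  "pauli_ops 0 = {1\<^sub>m 1}"
| "pauli_ops (Suc n) =
     {kron P Q | P Q. P \<in> {1\<^sub>m 2, pauli_X, pauli_Y, pauli_Z} \<and> Q \<in> pauli_ops n}"

text \<open>For \<open>n \<ge> 1\<close> the phases are exactly those arising in products of Pauli operators, because
  \<open>XYZ = \<i> 1\<close>.\<close>

definition pauli_group :: "nat \<Rightarrow> complex mat monoid" where
  "pauli_group n =
     \<lparr>carrier = {c \<cdot>\<^sub>m P | c P. c \<in> {1, - 1, \<i>, - \<i>} \<and> P \<in> pauli_ops n},
      monoid.mult = (*), one = 1\<^sub>m (2 ^ n)\<rparr>"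

definition abelian_pauli_subgroup :: "nat \<Rightarrow> complex mat set \<Rightarrow> bool" where
  "abelian_pauli_subgroup n A \<longleftrightarrow>
     subgroup A (pauli_group n) \<and>
     (\<forall>P\<in>A. \<forall>Q\<in>A. P * Q = Q * P) \<and>
     A \<subseteq> pauli_ops n \<union> uminus ` pauli_ops n \<and>
     - 1\<^sub>m (2 ^ n) \<notin> A"

definition Z2_power :: "nat \<Rightarrow> (nat \<Rightarrow> int) monoid" where
  "Z2_power m = product_group {..<m} (\<lambda>_. integer_mod_group 2)"

definition has_dimension :: "nat \<Rightarrow> complex mat set \<Rightarrow> nat \<Rightarrow> bool" where
  "has_dimension n A m \<longleftrightarrow> (pauli_group n)\<lparr>carrier := A\<rparr> \<cong> Z2_power m"

definition independent_generators :: "nat \<Rightarrow> complex mat set \<Rightarrow> complex mat list \<Rightarrow> bool" where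
  "independent_generators n A Ps \<longleftrightarrow>
     distinct Ps \<and> set Ps \<subseteq> A \<and>
     generate (pauli_group n) (set Ps) = A \<and>
     (\<forall>P \<in> set Ps. P \<notin> generate (pauli_group n) (set Ps - {P}))"

section \<open>States and complementarity\<close>

definition mat_trace :: "complex mat \<Rightarrow> complex" where
  "mat_trace M = (\<Sum>i<dim_row M. M $$ (i, i))"

text \<open>The product \<open>u \<bullet>c v\<close> conjugates its second argument; for self-adjoint \<open>\<rho>\<close> the
  quadratic form is real.\<close>

definition density_ops :: "nat \<Rightarrow> complex mat set" where
  "density_ops n = {\<rho> \<in> carrier_mat (2 ^ n) (2 ^ n).
     mat_adjoint \<rho> = \<rho> \<and>
     (\<forall>v \<in> carrier_vec (2 ^ n). 0 \<le> Re ((\<rho> *\<^sub>v v) \<bullet>c v)) \<and>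
     mat_trace \<rho> = 1}"

text \<open>Outcomes \<open>x\<close> range over the carrier of \<open>Z2_power (length Ps)\<close>, i.e. \<open>x k \<in> {0, 1}\<close>.\<close>

definition outcome_proj :: "nat \<Rightarrow> complex mat list \<Rightarrow> (nat \<Rightarrow> int) \<Rightarrow> complex mat" where
  "outcome_proj n Ps x =
     foldr (*)
       (map (\<lambda>k. (1 / 2) \<cdot>\<^sub>m (1\<^sub>m (2 ^ n) + ((- 1) ^ nat (x k)) \<cdot>\<^sub>m (Ps ! k))) [0..<length Ps])
       (1\<^sub>m (2 ^ n))"

definition outcome_prob ::
  "nat \<Rightarrow> complex mat list \<Rightarrow> complex mat \<Rightarrow> (nat \<Rightarrow> int) \<Rightarrow> complex" where
  "outcome_prob n Ps \<rho> x = mat_trace (outcome_proj n Ps x * \<rho>)"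

definition maximal_information :: "nat \<Rightarrow> complex mat list \<Rightarrow> complex mat \<Rightarrow> bool" where
  "maximal_information n Ps \<rho> \<longleftrightarrow>
     (\<exists>x0 \<in> carrier (Z2_power (length Ps)). \<forall>x \<in> carrier (Z2_power (length Ps)).
        outcome_prob n Ps \<rho> x = (if x = x0 then 1 else 0))"

definition unbiased :: "nat \<Rightarrow> complex mat list \<Rightarrow> complex mat \<Rightarrow> bool" where
  "unbiased n Ps \<rho> \<longleftrightarrow>
     (\<forall>x \<in> carrier (Z2_power (length Ps)). outcome_prob n Ps \<rho> x = 1 / 2 ^ length Ps)"

text \<open>Choosing other independent generators of the same group only permutes the projectors, so the
  two properties of states depend on the group alone. Complementarity is required for all choices
  of generators; that such choices exist is shown below.\<close>

definition complementary :: "nat \<Rightarrow> complex mat set \<Rightarrow> complex mat set \<Rightarrow> bool" where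
  "complementary n A B \<longleftrightarrow>
     (\<forall>Ps Qs. independent_generators n A Ps \<longrightarrow> independent_generators n B Qs \<longrightarrow>
        (\<forall>\<rho> \<in> density_ops n.
           (maximal_information n Ps \<rho> \<longrightarrow> unbiased n Qs \<rho>) \<and>
           (maximal_information n Qs \<rho> \<longrightarrow> unbiased n Ps \<rho>)))"

section \<open>Existence of independent generators\<close>

lemma pauli_ops_carrier: "P \<in> pauli_ops n \<Longrightarrow> P \<in> carrier_mat (2 ^ n) (2 ^ n)"
proof (induction n arbitrary: P)
  case (Suc n)
  then obtain R Q where P: "P = kron R Q" "R \<in> {1\<^sub>m 2, pauli_X, pauli_Y, pauli_Z}"
    and Q: "Q \<in> carrier_mat (2 ^ n) (2 ^ n)" by auto
  have "R \<in> carrier_mat 2 2"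
    using P(2) by (auto simp: pauli_X_def pauli_Y_def pauli_Z_def mat_of_rows_list_def)
  with P(1) Q show ?case by (auto simp: kron_def)
qed simp

lemma pauli_group_carrier:
  "P \<in> carrier (pauli_group n) \<Longrightarrow> P \<in> carrier_mat (2 ^ n) (2 ^ n)"
  by (auto simp: pauli_group_def dest: pauli_ops_carrier)

lemma subgroup_involutions:
  assumes A: "subgroup A (pauli_group n)" and dim: "has_dimension n A m" and P: "P \<in> A"
  shows "P * P = 1\<^sub>m (2 ^ n)" and "inv\<^bsub>pauli_group n\<^esub> P = P"
proof -
  let ?G = "pauli_group n"
  have sub: "A \<subseteq> carrier ?G" and one: "1\<^sub>m (2 ^ n) \<in> A"
    and mult: "\<And>x y. x \<in> A \<Longrightarrow> y \<in> A \<Longrightarrow> x * y \<in> A"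
    using subgroup.subset[OF A] subgroup.one_closed[OF A] subgroup.m_closed[OF A]
    by (auto simp: pauli_group_def)
  obtain h where h: "h \<in> iso (?G\<lparr>carrier := A\<rparr>) (Z2_power m)"
    using dim by (auto simp: has_dimension_def is_iso_def)
  have hc: "h x \<in> carrier (Z2_power m)" if "x \<in> A" for x
    using h that by (auto simp: iso_def hom_def)
  have hm: "h (x * y) = h x \<otimes>\<^bsub>Z2_power m\<^esub> h y" if "x \<in> A" "y \<in> A" for x y
    using h that by (auto simp: iso_def hom_def pauli_group_def)
  have inj: "x = y" if "h x = h y" "x \<in> A" "y \<in> A" for x y
    using h that by (auto simp: iso_def bij_betw_def inj_on_def)
  have sq: "u \<otimes>\<^bsub>Z2_power m\<^esub> u = \<one>\<^bsub>Z2_power m\<^esub>" if "u \<in> carrier (Z2_power m)" for u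
  proof -
    have "(u i + u i) mod 2 = 0" for i by presburger
    then show ?thesis
      by (auto simp: Z2_power_def product_group_def integer_mod_group_def restrict_def)
  qed
  have "h (P * P) = h (1\<^sub>m (2 ^ n) * 1\<^sub>m (2 ^ n))"
    using sq[OF hc[OF P]] sq[OF hc[OF one]] hm[OF P P] hm[OF one one] by simp
  from inj[OF this mult[OF P P] mult[OF one one]] show PP: "P * P = 1\<^sub>m (2 ^ n)" by simp
  show "inv\<^bsub>?G\<^esub> P = P"
    unfolding m_inv_def
  proof (rule the_equality)
    show "P \<in> carrier ?G \<and> P \<otimes>\<^bsub>?G\<^esub> P = \<one>\<^bsub>?G\<^esub> \<and> P \<otimes>\<^bsub>?G\<^esub> P = \<one>\<^bsub>?G\<^esub>"
      using sub P PP by (auto simp: pauli_group_def)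
  next
    fix y assume y: "y \<in> carrier ?G \<and> P \<otimes>\<^bsub>?G\<^esub> y = \<one>\<^bsub>?G\<^esub> \<and> y \<otimes>\<^bsub>?G\<^esub> P = \<one>\<^bsub>?G\<^esub>"
    have cP: "P \<in> carrier_mat (2 ^ n) (2 ^ n)" and cy: "y \<in> carrier_mat (2 ^ n) (2 ^ n)"
      using sub P y pauli_group_carrier by auto
    have "P * y = 1\<^sub>m (2 ^ n)" using y by (simp add: pauli_group_def)
    then have "P * (P * y) = P" using cP by simp
    then show "y = P" using cP cy PP by (simp flip: assoc_mult_mat)
  qed
qed

lemma independent_generators_exist:
  assumes A: "abelian_pauli_subgroup n A" and dim: "has_dimension n A m"
  shows "\<exists>Ps. independent_generators n A Ps"
proof -
  let ?G = "pauli_group n"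
  have sg: "subgroup A ?G" using A by (simp add: abelian_pauli_subgroup_def)
  have fin: "finite A"
  proof -
    have "finite (carrier (Z2_power m))"
      by (auto simp: Z2_power_def product_group_def integer_mod_group_def intro!: finite_PiE)
    moreover obtain h where "h \<in> iso (?G\<lparr>carrier := A\<rparr>) (Z2_power m)"
      using dim by (auto simp: has_dimension_def is_iso_def)
    ultimately show ?thesis by (auto simp: iso_def dest: bij_betw_finite)
  qed
  have inv_eq: "inv\<^bsub>?G\<^esub> P = P" if "P \<in> A" for P
    using subgroup_involutions(2)[OF sg dim that] .
  have incl: "generate ?G T \<subseteq> generate ?G S" if "T \<subseteq> generate ?G S" "T \<subseteq> A" for S T
  proof
    fix x assume "x \<in> generate ?G T"
    then show "x \<in> generate ?G S"
    proof induction
      case (inv h)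
      then have "inv\<^bsub>?G\<^esub> h = h" using that inv_eq by blast
      with inv that show ?case by auto
    qed (use that in \<open>auto intro: generate.one generate.eng\<close>)
  qed
  have bound: "generate ?G S \<subseteq> A" if "S \<subseteq> A" for S
  proof
    fix x assume "x \<in> generate ?G S"
    then show "x \<in> A"
    proof induction
      case (inv h)
      then have "inv\<^bsub>?G\<^esub> h = h" using that inv_eq by blast
      with inv that show ?case by auto
    qed (use that subgroup.one_closed[OF sg] subgroup.m_closed[OF sg] in auto)
  qed
  define \<S> where "\<S> = {S. S \<subseteq> A \<and> generate ?G S = A}"
  have "A \<in> \<S>" using bound[of A] by (auto simp: \<S>_def intro: generate.incl)
  then obtain S where S: "S \<in> \<S>" and min: "\<And>T. T \<in> \<S> \<Longrightarrow> card S \<le> card T"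
    using arg_min_natI[of "\<lambda>S. S \<in> \<S>" A card] arg_min_nat_le[of "\<lambda>S. S \<in> \<S>" _ card] by metis
  have SA: "S \<subseteq> A" and gen: "generate ?G S = A" using S by (auto simp: \<S>_def)
  have finS: "finite S" using SA fin finite_subset by blast
  have "P \<notin> generate ?G (S - {P})" if P: "P \<in> S" for P
  proof
    assume "P \<in> generate ?G (S - {P})"
    then have "S \<subseteq> generate ?G (S - {P})" by (auto intro: generate.incl)
    then have "A \<subseteq> generate ?G (S - {P})" using incl[of S "S - {P}"] SA gen by simp
    moreover have "generate ?G (S - {P}) \<subseteq> A" using bound[of "S - {P}"] SA by auto
    ultimately have "S - {P} \<in> \<S>" using SA by (auto simp: \<S>_def)
    from min[OF this] show False
      using card_Diff1_less[OF finS P] by simp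
  qed
  moreover obtain Ps where "set Ps = S" "distinct Ps" using finite_distinct_list[OF finS] by auto
  ultimately show ?thesis using SA gen by (auto simp: independent_generators_def)
qed

end

theory Submission
  imports Defs "HOL-Library.Z2" "HOL-Algebra.Algebraic_Closure_Type"
begin

text \<open>
  A state of maximal information in \<open>A\<close> has expectation \<open>\<plusminus>1\<close> on every generator \<open>P\<close> of \<open>A\<close>, hence
  expectation \<open>0\<close> on every Pauli operator anticommuting with some \<open>P\<close>. So \<open>A\<close> and \<open>B\<close> are
  complementary as soon as the commutation pairing between them is nondegenerate.

  Identify labels of \<open>n\<close>-qubit Pauli operators with \<open>F \<times> F\<close>, where \<open>F\<close> is the field with \<open>2 ^ n\<close>
  elements, so that commutation is given by \<open>tr (s t' + t s')\<close>. Fix \<open>d\<close> with \<open>tr d = 1\<close>; the norm form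
  \<open>s\<^sup>2 + s t + d t\<^sup>2\<close> of the quadratic extension of \<open>F\<close> takes the value \<open>1\<close> at \<open>2 ^ n + 1\<close> points. To
  such a point \<open>(s, t)\<close> belongs the isotropic space \<open>{(s a, t a) | tr a = 0}\<close> of dimension \<open>n - 1\<close>.
  Two of these are paired by \<open>tr (a b T)\<close> with \<open>T = s t' + t s'\<close>, whose restriction to the trace zero
  elements is nondegenerate iff \<open>tr (1 / T) = 1\<close>. Multiplicativity of the norm gives
  \<open>1 = q\<^sup>2 + q T + d T\<^sup>2\<close> for some \<open>q\<close>, and dividing by \<open>T\<^sup>2\<close> shows \<open>tr (1 / T) = tr d = 1\<close>.
\<close>

section \<open>Labelling Pauli operators by bit vectors\<close>

declare add_bit_eq_xor [simp del] mult_bit_eq_and [simp del]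

section \<open>Kronecker products\<close>

lemma div_less_of_less_mult: "(i :: nat) < a * c \<Longrightarrow> i div c < a"
  by (simp add: less_mult_imp_div_less)

lemma mod_less_of_less_mult: "(i :: nat) < a * c \<Longrightarrow> i mod c < c"
  by (cases "c = 0") auto

text \<open>\<open>i * b + j\<close> enumerates the index pairs; this splits the summation index in
  a product of Kronecker products.\<close>

lemma sum_div_mod:
  fixes f :: "nat \<Rightarrow> nat \<Rightarrow> 'a :: comm_monoid_add"
  shows "(\<Sum>k<a * b. f (k div b) (k mod b)) = (\<Sum>i<a. \<Sum>j<b. f i j)"
proof -
  have bound: "i * b + j < a * b" if "i < a" "j < b" for i j
  proof -
    have "i * b + j < Suc i * b" using that by simp
    also have "\<dots> \<le> a * b" using that by (intro mult_right_mono) auto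
    finally show ?thesis .
  qed
  have "(\<Sum>i<a. \<Sum>j<b. f i j) = (\<Sum>(i, j)\<in>{..<a} \<times> {..<b}. f i j)"
    by (simp add: sum.cartesian_product)
  also have "\<dots> = (\<Sum>k<a * b. f (k div b) (k mod b))"
    by (rule sum.reindex_bij_witness[where i = "\<lambda>k. (k div b, k mod b)" and j = "\<lambda>(i, j). i * b + j"])
      (auto simp: less_mult_imp_div_less mult.commute bound mod_less_of_less_mult[of _ a])
  finally show ?thesis ..
qed

lemma kron_carrier:
  "A \<in> carrier_mat a b \<Longrightarrow> B \<in> carrier_mat c d \<Longrightarrow> kron A B \<in> carrier_mat (a * c) (b * d)"
  by (auto simp: kron_def)

lemma kron_mult:
  assumes "A \<in> carrier_mat a b" "B \<in> carrier_mat c d" "C \<in> carrier_mat b e" "D \<in> carrier_mat d f"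
  shows "kron A B * kron C D = kron (A * C) (B * D)"
proof (rule eq_matI)
  fix i j assume ij: "i < dim_row (kron (A * C) (B * D))" "j < dim_col (kron (A * C) (B * D))"
  then have i: "i < a * c" "i div c < a" "i mod c < c" and j: "j < e * f" "j div f < e" "j mod f < f"
    using assms by (auto simp: kron_def div_less_of_less_mult mod_less_of_less_mult)
  have "(kron A B * kron C D) $$ (i, j)
    = (\<Sum>k<b * d. (A $$ (i div c, k div d) * C $$ (k div d, j div f))
        * (B $$ (i mod c, k mod d) * D $$ (k mod d, j mod f)))"
    using assms i j by (auto simp: kron_def scalar_prod_def lessThan_atLeast0 ac_simps intro!: sum.cong)
  also have "\<dots> = (\<Sum>k<b. \<Sum>l<d. (A $$ (i div c, k) * C $$ (k, j div f))
        * (B $$ (i mod c, l) * D $$ (l, j mod f)))"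
    by (rule sum_div_mod)
  also have "\<dots> = kron (A * C) (B * D) $$ (i, j)"
    using assms i j by (auto simp: kron_def scalar_prod_def lessThan_atLeast0 sum_product)
  finally show "(kron A B * kron C D) $$ (i, j) = kron (A * C) (B * D) $$ (i, j)" .
qed (use assms in \<open>auto simp: kron_def\<close>)

lemma one_smult_mat [simp]: "(1 :: 'a :: monoid_mult) \<cdot>\<^sub>m A = A"
  by (rule eq_matI) auto

lemma kron_smult: "kron (a \<cdot>\<^sub>m A) (b \<cdot>\<^sub>m B) = (a * b) \<cdot>\<^sub>m kron A B"
  by (rule eq_matI) (auto simp: kron_def div_less_of_less_mult mod_less_of_less_mult)

lemma kron_one: "kron (1\<^sub>m a) (1\<^sub>m b) = 1\<^sub>m (a * b)"
proof (rule eq_matI)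
  fix i j assume "i < dim_row (1\<^sub>m (a * b) :: complex mat)" "j < dim_col (1\<^sub>m (a * b) :: complex mat)"
  then show "kron (1\<^sub>m a) (1\<^sub>m b) $$ (i, j) = 1\<^sub>m (a * b) $$ (i, j)"
    by (auto simp: kron_def div_less_of_less_mult mod_less_of_less_mult)
      (metis div_mult_mod_eq)
qed (auto simp: kron_def)

section \<open>Hermitian matrices\<close>

lemma index_mat_adjoint:
  "i < dim_col A \<Longrightarrow> j < dim_row A \<Longrightarrow> mat_adjoint A $$ (i, j) = conjugate (A $$ (j, i))"
  by (simp add: mat_adjoint_def mat_of_rows_def)

lemma dim_mat_adjoint [simp]:
  "dim_row (mat_adjoint A) = dim_col A" "dim_col (mat_adjoint A) = dim_row A"
  by (auto simp: mat_adjoint_def)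

lemma mat_adjoint_eqI:
  assumes "A \<in> carrier_mat d d" "\<And>i j. i < d \<Longrightarrow> j < d \<Longrightarrow> conjugate (A $$ (j, i)) = A $$ (i, j)"
  shows "mat_adjoint A = A"
  by (rule eq_matI) (use assms in \<open>auto simp: index_mat_adjoint\<close>)

lemma index_of_hermitian:
  assumes "A \<in> carrier_mat d d" "mat_adjoint A = A" "i < d" "j < d"
  shows "conjugate (A $$ (j, i)) = A $$ (i, j)"
  using index_mat_adjoint[of i A j] assms by auto

lemma kron_hermitian:
  assumes "A \<in> carrier_mat a a" "B \<in> carrier_mat b b" "mat_adjoint A = A" "mat_adjoint B = B"
  shows "mat_adjoint (kron A B) = kron A B"
proof (rule mat_adjoint_eqI[OF kron_carrier[OF assms(1,2)]])
  fix i j assume "i < a * b" "j < a * b"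
  then show "conjugate (kron A B $$ (j, i)) = kron A B $$ (i, j)"
    using assms(1,2) index_of_hermitian[OF assms(1,3), of "i div b" "j div b"]
      index_of_hermitian[OF assms(2,4), of "i mod b" "j mod b"]
    by (simp add: kron_def div_less_of_less_mult mod_less_of_less_mult)
qed

text \<open>The label (1, 1) denotes Y itself and not XZ = -iY. All labelled operators are thus
  Hermitian involutions, at the price of phases in products.\<close>

definition pauli1 :: "bit \<Rightarrow> bit \<Rightarrow> complex mat" where
  "pauli1 x z = (if x = 0 then if z = 0 then 1\<^sub>m 2 else pauli_Z else if z = 0 then pauli_X else pauli_Y)"

fun pauli :: "nat \<Rightarrow> (nat \<Rightarrow> bit) \<Rightarrow> (nat \<Rightarrow> bit) \<Rightarrow> complex mat" where
  "pauli 0 x z = 1\<^sub>m 1"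
| "pauli (Suc n) x z = kron (pauli1 (x 0) (z 0)) (pauli n (\<lambda>i. x (Suc i)) (\<lambda>i. z (Suc i)))"

definition phases :: "complex set" where
  "phases = {1, - 1, \<i>, - \<i>}"

lemma phases_mult: "a \<in> phases \<Longrightarrow> b \<in> phases \<Longrightarrow> a * b \<in> phases"
  by (auto simp: phases_def)

lemma pauli1_carrier [simp]: "pauli1 x z \<in> carrier_mat 2 2"
  by (auto simp: pauli1_def pauli_X_def pauli_Y_def pauli_Z_def mat_of_rows_list_def)

lemma mat2_eqI:
  assumes "A \<in> carrier_mat 2 2" "B \<in> carrier_mat 2 2"
    "A $$ (0, 0) = B $$ (0, 0)" "A $$ (0, 1) = B $$ (0, 1)"
    "A $$ (1, 0) = B $$ (1, 0)" "A $$ (1, 1) = B $$ (1, 1)"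
  shows "A = B"
  by (rule eq_matI) (use assms in \<open>auto simp: less_2_cases_iff\<close>)

lemma mat2_mult_index:
  assumes "A \<in> carrier_mat 2 2" "B \<in> carrier_mat 2 2" "i < 2" "j < 2"
  shows "(A * B) $$ (i, j) = A $$ (i, 0) * B $$ (0, j) + A $$ (i, 1) * B $$ (1, j)"
  using assms by (auto simp: scalar_prod_def numeral_2_eq_2)

lemma pauli1_index:
  "pauli1 x z $$ (0, 0) = (if x = 0 then 1 else 0)"
  "pauli1 x z $$ (0, 1) = (if x = 0 then 0 else if z = 0 then 1 else - \<i>)"
  "pauli1 x z $$ (1, 0) = (if x = 0 then 0 else if z = 0 then 1 else \<i>)"
  "pauli1 x z $$ (1, 1) = (if x = 0 then if z = 0 then 1 else - 1 else 0)"
  by (auto simp: pauli1_def pauli_X_def pauli_Y_def pauli_Z_def mat_of_rows_list_def)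

lemma pauli1_hermitian: "mat_adjoint (pauli1 x z) = pauli1 x z"
  by (rule mat_adjoint_eqI[OF pauli1_carrier])
    (auto simp: less_2_cases_iff pauli1_index[simplified])

lemma pauli1_mult:
  obtains c where "c \<in> phases" "pauli1 x z * pauli1 x' z' = c \<cdot>\<^sub>m pauli1 (x + x') (z + z')"
proof -
  \<comment> \<open>Row 0 of a one-qubit Pauli matrix has a single nonzero entry, in column 0 or 1
    according to its x label; comparing both sides there yields the only possible phase.\<close>
  define c where "c = (pauli1 x z * pauli1 x' z') $$ (0, if x + x' = 0 then 0 else 1)
     / pauli1 (x + x') (z + z') $$ (0, if x + x' = 0 then 0 else 1)"
  have "c \<in> phases"
    by (cases x; cases z; cases x'; cases z')
      (auto simp: c_def phases_def pauli1_index mat2_mult_index[OF pauli1_carrier pauli1_carrier] simp del: index_mult_mat One_nat_def)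
  moreover have "pauli1 x z * pauli1 x' z' = c \<cdot>\<^sub>m pauli1 (x + x') (z + z')"
    by (rule mat2_eqI[OF mult_carrier_mat[OF pauli1_carrier pauli1_carrier] smult_carrier_mat[OF pauli1_carrier]];
        cases x; cases z; cases x'; cases z')
      (auto simp: c_def pauli1_index carrier_matD[OF pauli1_carrier]
        mat2_mult_index[OF pauli1_carrier pauli1_carrier] simp del: index_mult_mat(1) One_nat_def)
  ultimately show ?thesis by (rule that)
qed

definition bit_sign :: "bit \<Rightarrow> complex" where
  "bit_sign b = (if b = 0 then 1 else - 1)"

lemma bit_sign_simps [simp]: "bit_sign 0 = 1" "bit_sign 1 = - 1"
  by (auto simp: bit_sign_def)

lemma bit_sign_add: "bit_sign (a + b) = bit_sign a * bit_sign b"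
  by (cases a; cases b) auto

lemma pauli1_commute:
  "pauli1 x z * pauli1 x' z' = bit_sign (x * z' + z * x') \<cdot>\<^sub>m (pauli1 x' z' * pauli1 x z)"
  by (rule mat2_eqI; cases x; cases z; cases x'; cases z')
    (auto simp: pauli1_index carrier_matD[OF pauli1_carrier]
      mat2_mult_index[OF pauli1_carrier pauli1_carrier] simp del: index_mult_mat(1) One_nat_def)

section \<open>Tensor products of Pauli matrices\<close>

lemma pauli_carrier [simp]: "pauli n x z \<in> carrier_mat (2 ^ n) (2 ^ n)"
proof (induction n arbitrary: x z)
  case (Suc n)
  then show ?case using kron_carrier[OF pauli1_carrier] by simp
qed simp

lemma pauli_in_pauli_ops: "pauli n x z \<in> pauli_ops n"
  by (induction n arbitrary: x z) (auto simp: pauli1_def)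

lemma pauli_ops_cases:
  assumes "P \<in> pauli_ops n" obtains x z where "P = pauli n x z"
proof -
  have "\<exists>x z. P = pauli n x z"
    using assms
  proof (induction n arbitrary: P)
    case (Suc n)
    then obtain A Q where P: "P = kron A Q" "A \<in> {1\<^sub>m 2, pauli_X, pauli_Y, pauli_Z}" "Q \<in> pauli_ops n"
      by auto
    with Suc.IH obtain x z where Q: "Q = pauli n x z" by blast
    have "A = pauli1 0 0 \<or> A = pauli1 1 0 \<or> A = pauli1 1 1 \<or> A = pauli1 0 1"
      using P(2) by (auto simp: pauli1_def)
    then obtain a b where "A = pauli1 a b" by blast
    then have "P = pauli (Suc n) (case_nat a x) (case_nat b z)" using P Q by simp
    then show ?case by blast
  qed auto
  with that show ?thesis by blast
qed

lemma pauli_ops_eq: "pauli_ops n = {pauli n x z | x z. True}"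
  using pauli_in_pauli_ops pauli_ops_cases by blast

lemma pauli_zero: "pauli n (\<lambda>_. 0) (\<lambda>_. 0) = 1\<^sub>m (2 ^ n)"
  by (induction n) (auto simp: pauli1_def kron_one)

lemma pauli_hermitian: "mat_adjoint (pauli n x z) = pauli n x z"
proof (induction n arbitrary: x z)
  case 0
  show ?case unfolding pauli.simps by (rule mat_adjoint_eqI[of _ 1]) auto
next
  case (Suc n)
  then show ?case
    unfolding pauli.simps by (intro kron_hermitian[OF pauli1_carrier pauli_carrier] pauli1_hermitian)
qed

lemma pauli_mult:
  obtains c where "c \<in> phases"
    "pauli n x z * pauli n x' z' = c \<cdot>\<^sub>m pauli n (\<lambda>i. x i + x' i) (\<lambda>i. z i + z' i)"
proof -
  have "\<exists>c\<in>phases. pauli n x z * pauli n x' z' = c \<cdot>\<^sub>m pauli n (\<lambda>i. x i + x' i) (\<lambda>i. z i + z' i)"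
  proof (induction n arbitrary: x z x' z')
    case 0
    have "pauli 0 x z * pauli 0 x' z' = 1 \<cdot>\<^sub>m pauli 0 (\<lambda>i. x i + x' i) (\<lambda>i. z i + z' i)"
      by simp
    then show ?case by (intro bexI[of _ 1]) (auto simp: phases_def)
  next
    case (Suc n)
    obtain c where c: "c \<in> phases"
      "pauli n (\<lambda>i. x (Suc i)) (\<lambda>i. z (Suc i)) * pauli n (\<lambda>i. x' (Suc i)) (\<lambda>i. z' (Suc i))
        = c \<cdot>\<^sub>m pauli n (\<lambda>i. x (Suc i) + x' (Suc i)) (\<lambda>i. z (Suc i) + z' (Suc i))"
      using Suc by blast
    obtain c' where c': "c' \<in> phases"
      "pauli1 (x 0) (z 0) * pauli1 (x' 0) (z' 0) = c' \<cdot>\<^sub>m pauli1 (x 0 + x' 0) (z 0 + z' 0)"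
      by (rule pauli1_mult)
    show ?case
      using c c' by (intro bexI[of _ "c' * c"])
        (simp_all add: phases_mult kron_smult
          kron_mult[OF pauli1_carrier pauli_carrier pauli1_carrier pauli_carrier])
  qed
  with that show ?thesis by blast
qed

text \<open>The signs of the tensor factors multiply, so their exponents add up to the symplectic
  form of the labels. Commutation thereby becomes bilinear algebra over the two-element
  field.\<close>

lemma pauli_commute:
  "pauli n x z * pauli n x' z' =
    bit_sign (\<Sum>i<n. x i * z' i + z i * x' i) \<cdot>\<^sub>m (pauli n x' z' * pauli n x z)"
proof (induction n arbitrary: x z x' z')
  case 0
  have "(1 :: complex) \<cdot>\<^sub>m 1\<^sub>m 1 = 1\<^sub>m 1" by auto
  then show ?case by simp
next
  case (Suc n)
  have "pauli (Suc n) x z * pauli (Suc n) x' z'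
    = kron (pauli1 (x 0) (z 0) * pauli1 (x' 0) (z' 0))
        (pauli n (\<lambda>i. x (Suc i)) (\<lambda>i. z (Suc i)) * pauli n (\<lambda>i. x' (Suc i)) (\<lambda>i. z' (Suc i)))"
    by (simp add: kron_mult[OF pauli1_carrier pauli_carrier pauli1_carrier pauli_carrier])
  also have "\<dots> = bit_sign (\<Sum>i<Suc n. x i * z' i + z i * x' i) \<cdot>\<^sub>m
      kron (pauli1 (x' 0) (z' 0) * pauli1 (x 0) (z 0))
        (pauli n (\<lambda>i. x' (Suc i)) (\<lambda>i. z' (Suc i)) * pauli n (\<lambda>i. x (Suc i)) (\<lambda>i. z (Suc i)))"
    unfolding pauli1_commute[of "x 0"] Suc.IH[of "\<lambda>i. x (Suc i)"] kron_smult
    by (simp only: sum.lessThan_Suc_shift bit_sign_add)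
  also have "\<dots> = bit_sign (\<Sum>i<Suc n. x i * z' i + z i * x' i) \<cdot>\<^sub>m (pauli (Suc n) x' z' * pauli (Suc n) x z)"
    by (simp add: kron_mult[OF pauli1_carrier pauli_carrier pauli1_carrier pauli_carrier])
  finally show ?case .
qed

lemma pauli1_square: "pauli1 x z * pauli1 x z = 1\<^sub>m 2"
  by (rule mat2_eqI; cases x; cases z)
    (auto simp: pauli1_index carrier_matD[OF pauli1_carrier]
      mat2_mult_index[OF pauli1_carrier pauli1_carrier] simp del: index_mult_mat(1) One_nat_def)

lemma pauli_square: "pauli n x z * pauli n x z = 1\<^sub>m (2 ^ n)"
  by (induction n arbitrary: x z)
    (simp_all add: kron_mult[OF pauli1_carrier pauli_carrier pauli1_carrier pauli_carrier]
      pauli1_square kron_one)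

section \<open>The Pauli group\<close>

lemma pauli_group_simps:
  "carrier (pauli_group n) = {c \<cdot>\<^sub>m pauli n x z | c x z. c \<in> phases}"
  "x \<otimes>\<^bsub>pauli_group n\<^esub> y = x * y" "\<one>\<^bsub>pauli_group n\<^esub> = 1\<^sub>m (2 ^ n)"
  by (simp_all add: pauli_group_def pauli_ops_eq flip: phases_def) blast

lemma smult_mult_smult_mat:
  assumes "A \<in> carrier_mat d d" "B \<in> carrier_mat d d"
  shows "(a \<cdot>\<^sub>m A) * (b \<cdot>\<^sub>m B) = (a * b :: 'a :: comm_ring_1) \<cdot>\<^sub>m (A * B)"
  by (rule eq_matI) (use assms in \<open>auto simp: ac_simps\<close>)

lemma group_pauli_group: "group (pauli_group n)"
proof (rule groupI; unfold pauli_group_simps)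
  fix P Q assume "P \<in> {c \<cdot>\<^sub>m pauli n x z | c x z. c \<in> phases}" "Q \<in> {c \<cdot>\<^sub>m pauli n x z | c x z. c \<in> phases}"
  then obtain a x z b x' z' where PQ: "P = a \<cdot>\<^sub>m pauli n x z" "Q = b \<cdot>\<^sub>m pauli n x' z'"
    and ab: "a \<in> phases" "b \<in> phases" by blast
  obtain c where "c \<in> phases"
    "pauli n x z * pauli n x' z' = c \<cdot>\<^sub>m pauli n (\<lambda>i. x i + x' i) (\<lambda>i. z i + z' i)"
    by (rule pauli_mult)
  with ab show "P * Q \<in> {c \<cdot>\<^sub>m pauli n x z | c x z. c \<in> phases}"
    unfolding PQ by (force simp: smult_mult_smult_mat[OF pauli_carrier pauli_carrier] phases_mult)
next
  show "1\<^sub>m (2 ^ n) \<in> {c \<cdot>\<^sub>m pauli n x z | c x z. c \<in> phases}"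
    unfolding pauli_zero[symmetric] by (force simp: phases_def)
next
  fix P Q R
  assume "P \<in> {c \<cdot>\<^sub>m pauli n x z | c x z. c \<in> phases}"
    "Q \<in> {c \<cdot>\<^sub>m pauli n x z | c x z. c \<in> phases}" "R \<in> {c \<cdot>\<^sub>m pauli n x z | c x z. c \<in> phases}"
  then show "P * Q * R = P * (Q * R)"
    by (intro assoc_mult_mat[of _ "2 ^ n" "2 ^ n" _ "2 ^ n" _ "2 ^ n"]) auto
next
  fix P assume "P \<in> {c \<cdot>\<^sub>m pauli n x z | c x z. c \<in> phases}"
  then show "1\<^sub>m (2 ^ n) * P = P"
    using left_mult_one_mat[OF smult_carrier_mat[OF pauli_carrier]] by auto
next
  fix P assume "P \<in> {c \<cdot>\<^sub>m pauli n x z | c x z. c \<in> phases}"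
  then obtain a x z where P: "P = a \<cdot>\<^sub>m pauli n x z" and a: "a \<in> phases" by blast
  have "inverse a \<in> phases" "inverse a * a = 1" using a by (auto simp: phases_def)
  then show "\<exists>Q\<in>{c \<cdot>\<^sub>m pauli n x z | c x z. c \<in> phases}. Q * P = 1\<^sub>m (2 ^ n)"
    unfolding P
    by (intro bexI[of _ "inverse a \<cdot>\<^sub>m pauli n x z"])
      (auto simp: smult_mult_smult_mat[OF pauli_carrier pauli_carrier] pauli_square)
qed

section \<open>Expectation values\<close>

lemma mat_adjoint_mult:
  assumes "A \<in> carrier_mat a b" "B \<in> carrier_mat b c"
  shows "mat_adjoint (A * B) = mat_adjoint B * mat_adjoint (A :: complex mat)"
  by (rule eq_matI)
    (use assms in \<open>auto simp: index_mat_adjoint scalar_prod_def cnj_sum ac_simps intro!: sum.cong\<close>)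

lemma mat_adjoint_add:
  assumes "A \<in> carrier_mat a b" "B \<in> carrier_mat a b"
  shows "mat_adjoint (A + B) = mat_adjoint A + mat_adjoint (B :: complex mat)"
  by (rule eq_matI) (use assms in \<open>auto simp: index_mat_adjoint\<close>)

lemma mat_adjoint_minus:
  assumes "A \<in> carrier_mat a b" "B \<in> carrier_mat a b"
  shows "mat_adjoint (A - B) = mat_adjoint A - mat_adjoint (B :: complex mat)"
  by (rule eq_matI) (use assms in \<open>auto simp: index_mat_adjoint\<close>)

lemma mat_adjoint_smult: "mat_adjoint (c \<cdot>\<^sub>m A) = cnj c \<cdot>\<^sub>m mat_adjoint A"
  by (rule eq_matI) (auto simp: index_mat_adjoint)

lemma mat_adjoint_one: "mat_adjoint (1\<^sub>m d :: complex mat) = 1\<^sub>m d"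
  by (rule eq_matI) (auto simp: index_mat_adjoint)

lemma mat_trace_mult:
  assumes "A \<in> carrier_mat a b" "B \<in> carrier_mat b a"
  shows "mat_trace (A * B) = (\<Sum>i<a. \<Sum>j<b. A $$ (i, j) * B $$ (j, i))"
  using assms by (auto simp: mat_trace_def scalar_prod_def lessThan_atLeast0)

lemma mat_trace_mult_comm:
  assumes "A \<in> carrier_mat a b" "B \<in> carrier_mat b a"
  shows "mat_trace (A * B) = mat_trace (B * A)"
  using assms by (subst (1 2) mat_trace_mult) (auto simp: mult.commute intro: sum.swap)

section \<open>Products of commuting projections\<close>

definition commuting_projections :: "nat \<Rightarrow> complex mat list \<Rightarrow> bool" where
  "commuting_projections d Es \<longleftrightarrow>
    (\<forall>E\<in>set Es. E \<in> carrier_mat d d \<and> mat_adjoint E = E \<and> E * E = E) \<and>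
    (\<forall>E\<in>set Es. \<forall>F\<in>set Es. E * F = F * E)"

lemma foldr_mult_carrier:
  "set Es \<subseteq> carrier_mat d d \<Longrightarrow> foldr (*) Es (1\<^sub>m d) \<in> carrier_mat d d"
  by (induction Es) auto

lemma foldr_mult_commute:
  assumes "set Es \<subseteq> carrier_mat d d" "M \<in> carrier_mat d d" "\<And>E. E \<in> set Es \<Longrightarrow> M * E = E * M"
  shows "M * foldr (*) Es (1\<^sub>m d) = foldr (*) Es (1\<^sub>m d) * (M :: complex mat)"
  using assms
proof (induction Es)
  case (Cons E Es)
  let ?R = "foldr (*) Es (1\<^sub>m d)"
  have c [simp]: "E \<in> carrier_mat d d" "?R \<in> carrier_mat d d" "M \<in> carrier_mat d d"
    using Cons.prems foldr_mult_carrier[of Es] by auto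
  have "M * (E * ?R) = E * (M * ?R)"
    using Cons.prems(3)[of E] by (simp flip: assoc_mult_mat[of _ d d _ d _ d])
  also have "M * ?R = ?R * M" using Cons by auto
  finally show ?case by (simp add: assoc_mult_mat[of _ d d _ d _ d])
qed simp

text \<open>The product is the orthogonal projection onto the intersection of the ranges, so each
  factor is absorbed by it from either side.\<close>

lemma commuting_projections_foldr:
  assumes "commuting_projections d Es"
  defines "R \<equiv> foldr (*) Es (1\<^sub>m d)"
  shows "R \<in> carrier_mat d d" "mat_adjoint R = R" "\<And>E. E \<in> set Es \<Longrightarrow> E * R = R"
    "\<And>E. E \<in> set Es \<Longrightarrow> R * E = R" "R * R = R"
proof -
  have Es: "E \<in> carrier_mat d d" "mat_adjoint E = E" "E * E = E" "F \<in> set Es \<Longrightarrow> E * F = F * E"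
    if "E \<in> set Es" for E F
    using assms that by (auto simp: commuting_projections_def)
  show R: "R \<in> carrier_mat d d" unfolding R_def using Es by (intro foldr_mult_carrier) auto
  \<comment> \<open>Stated for all lists over \<open>Es\<close> so that induction applies:
    \<open>E\<close> moves past the other factors until it meets its own copy, where idempotence
    absorbs it.\<close>
  have abs: "E * foldr (*) Fs (1\<^sub>m d) = foldr (*) Fs (1\<^sub>m d)" if "E \<in> set Fs" "set Fs \<subseteq> set Es" for E Fs
    using that
  proof (induction Fs)
    case (Cons F Fs)
    let ?R = "foldr (*) Fs (1\<^sub>m d)"
    have c [simp]: "E \<in> carrier_mat d d" "F \<in> carrier_mat d d" "?R \<in> carrier_mat d d"
      using Cons.prems Es(1) by (auto intro!: foldr_mult_carrier)
    have "E * (F * ?R) = F * (E * ?R)"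
      using Es(4)[of E F] Cons.prems by (simp flip: assoc_mult_mat[of _ d d _ d _ d]) auto
    moreover have "E * (E * ?R) = E * ?R"
      using Es(3)[of E] Cons.prems by (simp flip: assoc_mult_mat[of _ d d _ d _ d]) auto
    ultimately show ?case using Cons by auto
  qed simp
  show ER: "E * R = R" if "E \<in> set Es" for E
    unfolding R_def using abs[OF that] by simp
  show "R * E = R" if "E \<in> set Es" for E
    using foldr_mult_commute[of Es d E] ER[OF that] Es that unfolding R_def by (auto simp: subset_iff)
  have "foldr (*) Fs (1\<^sub>m d) * R = R" if "set Fs \<subseteq> set Es" for Fs
    using that
  proof (induction Fs)
    case (Cons F Fs)
    have "foldr (*) (F # Fs) (1\<^sub>m d) * R = F * (foldr (*) Fs (1\<^sub>m d) * R)"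
      using Cons.prems Es(1) R by (auto intro!: assoc_mult_mat[of _ d d _ d _ d] foldr_mult_carrier)
    then show ?case using Cons ER by auto
  qed (use R in simp)
  then show "R * R = R" by (auto simp: R_def)
  have "mat_adjoint (foldr (*) Fs (1\<^sub>m d)) = foldr (*) Fs (1\<^sub>m d)" if "set Fs \<subseteq> set Es" for Fs
    using that
  proof (induction Fs)
    case (Cons F Fs)
    let ?R = "foldr (*) Fs (1\<^sub>m d)"
    have c: "F \<in> carrier_mat d d" "?R \<in> carrier_mat d d"
      using Cons.prems Es(1) by (auto intro!: foldr_mult_carrier)
    have "mat_adjoint (F * ?R) = ?R * F"
      using Cons Es(2)[of F] by (simp add: mat_adjoint_mult[OF c])
    also have "\<dots> = F * ?R"
      using Cons.prems Es by (intro foldr_mult_commute[symmetric]) auto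
    finally show ?case by simp
  qed (simp add: mat_adjoint_one)
  then show "mat_adjoint R = R" by (simp add: R_def)
qed

section \<open>Expectation values of Hermitian operators in a state\<close>

definition expval :: "complex mat \<Rightarrow> complex mat \<Rightarrow> complex" where
  "expval \<rho> M = mat_trace (M * \<rho>)"

context
  fixes n :: nat and \<rho> :: "complex mat" and d :: nat
  assumes \<rho>: "\<rho> \<in> density_ops n" and d: "d = 2 ^ n"
begin

lemma density_carrier: "\<rho> \<in> carrier_mat d d"
  using \<rho> by (simp add: density_ops_def d)

lemma expval_one: "expval \<rho> (1\<^sub>m d) = 1"
  using \<rho> density_carrier by (simp add: density_ops_def expval_def)

lemma expval_add:
  "A \<in> carrier_mat d d \<Longrightarrow> B \<in> carrier_mat d d \<Longrightarrow> expval \<rho> (A + B) = expval \<rho> A + expval \<rho> B"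
  unfolding expval_def using density_carrier
  by (simp add: mat_trace_mult[of _ d d] distrib_right sum.distrib)

lemma expval_minus:
  "A \<in> carrier_mat d d \<Longrightarrow> B \<in> carrier_mat d d \<Longrightarrow> expval \<rho> (A - B) = expval \<rho> A - expval \<rho> B"
  unfolding expval_def using density_carrier
  by (simp add: mat_trace_mult[of _ d d] minus_carrier_mat left_diff_distrib sum_subtractf)

lemma expval_zero: "expval \<rho> (0\<^sub>m d d) = 0"
  unfolding expval_def using density_carrier by (simp add: mat_trace_def)

lemma expval_smult: "A \<in> carrier_mat d d \<Longrightarrow> expval \<rho> (c \<cdot>\<^sub>m A) = c * expval \<rho> A"
  unfolding expval_def using density_carrier
  by (simp add: mat_trace_mult[of _ d d] sum_distrib_left mult.assoc)

text \<open>Conjugation transposes both Hermitian factors, and interchanging the two summations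
  restores the original trace.\<close>

lemma expval_hermitian_real:
  assumes M: "M \<in> carrier_mat d d" "mat_adjoint M = M"
  shows "Im (expval \<rho> M) = 0"
proof -
  have \<rho>': "mat_adjoint \<rho> = \<rho>" using \<rho> by (simp add: density_ops_def)
  have "cnj (expval \<rho> M) = (\<Sum>i<d. \<Sum>j<d. cnj (M $$ (i, j)) * cnj (\<rho> $$ (j, i)))"
    unfolding expval_def by (simp add: mat_trace_mult[OF M(1) density_carrier])
  also have "\<dots> = (\<Sum>i<d. \<Sum>j<d. M $$ (j, i) * \<rho> $$ (i, j))"
    using index_of_hermitian[OF M] index_of_hermitian[OF density_carrier \<rho>']
    by (intro sum.cong) auto
  also have "\<dots> = expval \<rho> M"
    unfolding expval_def mat_trace_mult[OF M(1) density_carrier] by (rule sum.swap)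
  finally show ?thesis by (metis Im_complex_of_real Reals_cnj_iff complex_is_Real_iff)
qed

text \<open>Cyclicity moves one \<open>M\<close> to the right of \<open>\<rho>\<close>; the diagonal
  entries of \<open>M * \<rho> * M\<close> are then values of the quadratic form of
  \<open>\<rho>\<close> at the columns of \<open>M\<close>.\<close>

lemma expval_square_nonneg:
  assumes M: "M \<in> carrier_mat d d" "mat_adjoint M = M"
  shows "Re (expval \<rho> (M * M)) \<ge> 0"
proof -
  note [simp] = density_carrier M(1) mult_carrier_mat[of _ d d _ d]
  have "expval \<rho> (M * M) = mat_trace (M * (M * \<rho>))"
    unfolding expval_def by (simp add: assoc_mult_mat[of _ d d _ d _ d])
  also have "\<dots> = mat_trace (M * \<rho> * M)"
    by (rule mat_trace_mult_comm[of _ d d]) auto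
  also have "\<dots> = mat_trace (M * (\<rho> * M))"
    by (simp add: assoc_mult_mat[of _ d d _ d _ d])
  also have "\<dots> = (\<Sum>i<d. (\<rho> *\<^sub>v col M i) \<bullet>c col M i)"
  proof -
    have "(\<Sum>j<d. M $$ (i, j) * (\<rho> * M) $$ (j, i)) = (\<rho> *\<^sub>v col M i) \<bullet>c col M i" if i: "i < d" for i
    proof -
      have "M $$ (i, j) = conjugate (M $$ (j, i))" if "j < d" for j
        using index_of_hermitian[OF M i that] by simp
      then show ?thesis
        using i carrier_matD[OF M(1)] carrier_matD[OF density_carrier]
        by (auto simp: scalar_prod_def lessThan_atLeast0 mult.commute intro!: sum.cong)
    qed
    then show ?thesis by (simp add: mat_trace_mult[of _ d d])
  qed
  also have "Re \<dots> = (\<Sum>i<d. Re ((\<rho> *\<^sub>v col M i) \<bullet>c col M i))"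
    by simp
  also have "\<dots> \<ge> 0"
    using \<rho> M(1) by (intro sum_nonneg) (auto simp: density_ops_def d)
  finally show ?thesis .
qed

text \<open>Evaluate the positive operator \<open>(1 - \<langle>P\<rangle> P - \<langle>Q\<rangle> Q)\<^sup>2\<close> in the state.\<close>

lemma expval_anticommuting:
  assumes P: "P \<in> carrier_mat d d" "mat_adjoint P = P" "P * P = 1\<^sub>m d"
    and Q: "Q \<in> carrier_mat d d" "mat_adjoint Q = Q" "Q * Q = 1\<^sub>m d"
    and anti: "P * Q = (- 1) \<cdot>\<^sub>m (Q * P)"
  shows "(Re (expval \<rho> P))\<^sup>2 + (Re (expval \<rho> Q))\<^sup>2 \<le> 1"
proof -
  define x y where "x = Re (expval \<rho> P)" and "y = Re (expval \<rho> Q)"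
  have ex: "expval \<rho> P = of_real x" "expval \<rho> Q = of_real y"
    using expval_hermitian_real[OF P(1,2)] expval_hermitian_real[OF Q(1,2)]
    by (auto simp: x_def y_def complex_eq_iff)
  define S where "S = complex_of_real x \<cdot>\<^sub>m P + complex_of_real y \<cdot>\<^sub>m Q"
  note [simp] = P(1) Q(1) mult_carrier_mat[of _ d d _ d]
  have S [simp]: "S \<in> carrier_mat d d" by (simp add: S_def)
  have S_herm: "mat_adjoint S = S"
    by (simp add: S_def mat_adjoint_add[of _ d d] mat_adjoint_smult P(2) Q(2))
  have "expval \<rho> S = of_real (x\<^sup>2 + y\<^sup>2)"
    by (simp add: S_def expval_add expval_smult ex power2_eq_square)
  \<comment> \<open>The cross terms cancel by anticommutation. Hence \<open>S\<close> and
    \<open>S * S\<close> have the same expectation, and that of (1 - S)^2 is 1 - (x^2 +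
    y^2).\<close>
  moreover have "expval \<rho> (S * S) = of_real (x\<^sup>2 + y\<^sup>2)"
  proof -
    have "S * S = complex_of_real x \<cdot>\<^sub>m P * (complex_of_real x \<cdot>\<^sub>m P) + complex_of_real y \<cdot>\<^sub>m Q * (complex_of_real x \<cdot>\<^sub>m P)
      + (complex_of_real x \<cdot>\<^sub>m P * (complex_of_real y \<cdot>\<^sub>m Q) + complex_of_real y \<cdot>\<^sub>m Q * (complex_of_real y \<cdot>\<^sub>m Q))"
      unfolding S_def by (simp add: add_mult_distrib_mat[of _ d d _ _ d] mult_add_distrib_mat[of _ d d _ d])
    also have "expval \<rho> \<dots> = of_real (x\<^sup>2 + y\<^sup>2)"
      by (simp add: smult_mult_smult_mat[of _ d] expval_add expval_smult anti P(3) Q(3) expval_one power2_eq_square)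
    finally show ?thesis .
  qed
  moreover have "0 \<le> Re (expval \<rho> ((1\<^sub>m d - S) * (1\<^sub>m d - S)))"
    by (rule expval_square_nonneg)
      (simp_all add: minus_carrier_mat mat_adjoint_minus[of _ d d] mat_adjoint_one S_herm)
  moreover have "(1\<^sub>m d - S) * (1\<^sub>m d - S) = 1\<^sub>m d - S - (S - S * S)"
    by (simp add: minus_carrier_mat minus_mult_distrib_mat[of _ d d _ _ d] mult_minus_distrib_mat[of _ d d _ d]
        left_mult_one_mat[of _ d d] right_mult_one_mat[of _ d d])
  ultimately have "0 \<le> 1 - (x\<^sup>2 + y\<^sup>2)"
    by (simp add: minus_carrier_mat expval_minus expval_one flip: of_real_power of_real_add)
  then show ?thesis by (simp add: x_def y_def)
qed

text \<open>As \<open>E\<close> is absorbed by the product \<open>?R\<close>, the difference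
  \<open>E - ?R\<close> is its own square.\<close>

lemma expval_projection_mono:
  assumes Es: "commuting_projections d Es" and E: "E \<in> set Es"
  shows "Re (expval \<rho> (foldr (*) Es (1\<^sub>m d))) \<le> Re (expval \<rho> E)"
proof -
  let ?R = "foldr (*) Es (1\<^sub>m d)"
  note R = commuting_projections_foldr[OF Es]
  have E': "E \<in> carrier_mat d d" "mat_adjoint E = E" "E * E = E"
    using Es E by (auto simp: commuting_projections_def)
  have "0 \<le> Re (expval \<rho> ((E - ?R) * (E - ?R)))"
    using E' R(1,2) by (intro expval_square_nonneg) (auto simp: mat_adjoint_minus)
  also have "expval \<rho> ((E - ?R) * (E - ?R)) = expval \<rho> E - expval \<rho> ?R"
    using E' R E by (simp add: minus_mult_distrib_mat[of _ d d _ _ d] mult_minus_distrib_mat[of _ d d _ d]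
        minus_carrier_mat expval_minus expval_zero)
  finally show ?thesis by simp
qed

end


section \<open>A criterion for complementarity\<close>

lemma uminus_mat_eq_smult: "- M = (- 1 :: 'a :: ring_1) \<cdot>\<^sub>m M"
  by (rule eq_matI) auto

section \<open>Elements of Abelian Pauli subgroups\<close>

lemma abelian_pauli_subgroup_cases:
  assumes A: "abelian_pauli_subgroup n A" and P: "P \<in> A"
  obtains e x z where "e \<in> {1, - 1}" "P = e \<cdot>\<^sub>m pauli n x z"
proof -
  have "P \<in> pauli_ops n \<or> (\<exists>Q\<in>pauli_ops n. P = (- 1) \<cdot>\<^sub>m Q)"
    using A P by (auto simp: abelian_pauli_subgroup_def uminus_mat_eq_smult)
  then show ?thesis
    using that[of 1] that[of "- 1"] by (auto elim!: pauli_ops_cases)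
qed

text \<open>This depends on the phase being a sign: a phase \<plusminus>\<i> would make the element
  anti-Hermitian with square -1.\<close>

lemma abelian_pauli_subgroup_elt:
  assumes "abelian_pauli_subgroup n A" "P \<in> A"
  shows "P \<in> carrier_mat (2 ^ n) (2 ^ n)" "mat_adjoint P = P" "P * P = 1\<^sub>m (2 ^ n)"
proof -
  obtain e x z where "e \<in> {1, - 1}" "P = e \<cdot>\<^sub>m pauli n x z"
    using assms by (rule abelian_pauli_subgroup_cases)
  then show "P \<in> carrier_mat (2 ^ n) (2 ^ n)" "mat_adjoint P = P" "P * P = 1\<^sub>m (2 ^ n)"
    by (auto simp: mat_adjoint_smult pauli_hermitian pauli_square
        smult_mult_smult_mat[OF pauli_carrier pauli_carrier])
qed

text \<open>\<open>pauli_commute\<close> allows only the factors 1 and -1 between the two orders,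
  and the signs of \<open>P\<close> and \<open>Q\<close> occur on both sides.\<close>

lemma abelian_pauli_subgroup_anticommute:
  assumes "abelian_pauli_subgroup n A" "P \<in> A" "abelian_pauli_subgroup n B" "Q \<in> B" "P * Q \<noteq> Q * P"
  shows "P * Q = (- 1) \<cdot>\<^sub>m (Q * P)"
proof -
  obtain e x z where P: "e \<in> {1, - 1}" "P = e \<cdot>\<^sub>m pauli n x z"
    using assms(1,2) by (rule abelian_pauli_subgroup_cases)
  obtain e' x' z' where Q: "e' \<in> {1, - 1}" "Q = e' \<cdot>\<^sub>m pauli n x' z'"
    using assms(3,4) by (rule abelian_pauli_subgroup_cases)
  define b where "b = (\<Sum>i<n. x i * z' i + z i * x' i)"
  have PQ: "P * Q = (e * e') \<cdot>\<^sub>m (bit_sign b \<cdot>\<^sub>m (pauli n x' z' * pauli n x z))"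
    unfolding P Q b_def smult_mult_smult_mat[OF pauli_carrier pauli_carrier]
    by (subst pauli_commute) simp
  have QP: "Q * P = (e * e') \<cdot>\<^sub>m (pauli n x' z' * pauli n x z)"
    unfolding P Q smult_mult_smult_mat[OF pauli_carrier pauli_carrier] by (simp add: mult.commute)
  have "b = 1" using assms(5) unfolding PQ QP by (cases b) auto
  then show ?thesis unfolding PQ QP by (intro eq_matI) auto
qed

text \<open>The centraliser of \<open>Q\<close> is closed under products, and inverses change
  nothing since the elements of \<open>A\<close> are involutions. In contraposition, failure to
  commute with some element of the generated group is already visible on a generator.\<close>

lemma generate_commute:
  assumes S: "S \<subseteq> A" and A: "abelian_pauli_subgroup n A" and Q: "Q \<in> carrier_mat (2 ^ n) (2 ^ n)"
    and comm: "\<And>P. P \<in> S \<Longrightarrow> P * Q = Q * P" and P: "P \<in> generate (pauli_group n) S"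
  shows "P * Q = Q * P"
proof -
  interpret group "pauli_group n" by (rule group_pauli_group)
  have sub: "subgroup A (pauli_group n)" using A by (simp add: abelian_pauli_subgroup_def)
  note carr = abelian_pauli_subgroup_elt(1)[OF A]
  have "P \<in> A \<and> P * Q = Q * P" using P
  proof (induction P)
    case one
    show ?case using subgroup.one_closed[OF sub] Q by (simp add: pauli_group_simps)
  next
    case (incl h)
    then show ?case using S comm by auto
  next
    case (inv h)
    then have h: "h \<in> A" using S by auto
    then have "inv\<^bsub>pauli_group n\<^esub> h = h"
      using abelian_pauli_subgroup_elt(3)[OF A h] subgroup.mem_carrier[OF sub h]
      by (intro inv_equality) (auto simp: pauli_group_simps)
    then show ?case using h comm inv by simp
  next
    case (eng h k)
    have [simp]: "h \<in> carrier_mat (2 ^ n) (2 ^ n)" "k \<in> carrier_mat (2 ^ n) (2 ^ n)" using eng carr by auto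
    note assoc = assoc_mult_mat[of _ "2 ^ n" "2 ^ n" _ "2 ^ n" _ "2 ^ n"]
    have "h * k * Q = h * (k * Q)" using Q by (intro assoc) auto
    also have "k * Q = Q * k" using eng by blast
    also have "h * (Q * k) = h * Q * k" using Q by (intro assoc[symmetric]) auto
    also have "h * Q = Q * h" using eng by blast
    also have "Q * h * k = Q * (h * k)" using Q by (intro assoc) auto
    finally show ?case using eng subgroup.m_closed[OF sub, of h k] by (simp add: pauli_group_simps)
  qed
  then show ?thesis ..
qed

text \<open>For a Hermitian involution \<open>P\<close> and \<open>e\<close> = \<plusminus>1 this is
  the spectral projection of \<open>P\<close> for the eigenvalue \<open>e\<close>.\<close>

definition eigenproj :: "nat \<Rightarrow> complex \<Rightarrow> complex mat \<Rightarrow> complex mat" where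
  "eigenproj d e P = (1 / 2) \<cdot>\<^sub>m (1\<^sub>m d + e \<cdot>\<^sub>m P)"

lemma eigenproj_carrier [simp]: "P \<in> carrier_mat d d \<Longrightarrow> eigenproj d e P \<in> carrier_mat d d"
  by (simp add: eigenproj_def)

lemma eigenproj_mult:
  assumes "P \<in> carrier_mat d d" "Q \<in> carrier_mat d d"
  shows "eigenproj d e P * Q = (1 / 2) \<cdot>\<^sub>m (Q + e \<cdot>\<^sub>m (P * Q))"
  using assms unfolding eigenproj_def
  by (simp add: mult_smult_assoc_mat[of _ d d _ d] add_mult_distrib_mat[of _ d d _ _ d])

lemma mult_eigenproj:
  assumes "P \<in> carrier_mat d d" "Q \<in> carrier_mat d d"
  shows "Q * eigenproj d e P = (1 / 2) \<cdot>\<^sub>m (Q + e \<cdot>\<^sub>m (Q * P))"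
  using assms unfolding eigenproj_def
  by (simp add: mult_smult_distrib[of _ d d _ d] mult_add_distrib_mat[of _ d d _ d])

lemma outcome_proj_eigenproj:
  "outcome_proj n Ps x = foldr (*)
    (map (\<lambda>k. eigenproj (2 ^ n) ((- 1) ^ nat (x k)) (Ps ! k)) [0..<length Ps]) (1\<^sub>m (2 ^ n))"
  by (simp add: outcome_proj_def eigenproj_def)

lemma eigenproj_commuting_projections:
  assumes A: "abelian_pauli_subgroup n A" and Ps: "set Ps \<subseteq> A" and e: "\<And>k. e k \<in> {1, - 1}"
  shows "commuting_projections (2 ^ n) (map (\<lambda>k. eigenproj (2 ^ n) (e k) (Ps ! k)) [0..<length Ps])"
proof -
  let ?d = "2 ^ n :: nat"
  note elt = abelian_pauli_subgroup_elt[OF A]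
  have in_A: "Ps ! k \<in> A" if "k < length Ps" for k using Ps that by auto
  have herm: "mat_adjoint (eigenproj ?d e P) = eigenproj ?d e P" if "P \<in> A" "e \<in> {1, - 1}" for P e
    using elt(1,2)[OF that(1)] that(2)
    by (auto simp: eigenproj_def mat_adjoint_smult mat_adjoint_add[of _ ?d ?d] mat_adjoint_one)
  have idem: "eigenproj ?d e P * eigenproj ?d e P = eigenproj ?d e P" if "P \<in> A" "e \<in> {1, - 1}" for P e
  proof -
    have [simp]: "P \<in> carrier_mat ?d ?d" and PP: "P * P = 1\<^sub>m ?d" using elt[OF that(1)] by auto
    have "P * eigenproj ?d e P = (1 / 2) \<cdot>\<^sub>m (P + e \<cdot>\<^sub>m 1\<^sub>m ?d)"
      by (simp add: mult_eigenproj PP)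
    then have "eigenproj ?d e P * eigenproj ?d e P
      = (1 / 2) \<cdot>\<^sub>m (eigenproj ?d e P + e \<cdot>\<^sub>m ((1 / 2) \<cdot>\<^sub>m (P + e \<cdot>\<^sub>m 1\<^sub>m ?d)))"
      by (simp add: eigenproj_mult)
    also have "\<dots> = eigenproj ?d e P"
      by (rule eq_matI) (use that(2) carrier_matD[OF elt(1)[OF that(1)]] in \<open>auto simp: eigenproj_def field_simps\<close>)
    finally show ?thesis .
  qed
  have comm: "eigenproj ?d e P * eigenproj ?d e' Q = eigenproj ?d e' Q * eigenproj ?d e P"
    if "P \<in> A" "Q \<in> A" for P Q e e'
  proof -
    have [simp]: "P \<in> carrier_mat ?d ?d" "Q \<in> carrier_mat ?d ?d" and PQ: "P * Q = Q * P"
      using elt(1) that A by (auto simp: abelian_pauli_subgroup_def)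
    have "eigenproj ?d e P * Q = Q * eigenproj ?d e P"
      by (simp add: eigenproj_mult mult_eigenproj PQ)
    then show ?thesis
      by (simp add: eigenproj_mult[of Q] mult_eigenproj[of Q])
  qed
  show ?thesis
    unfolding commuting_projections_def
    using in_A elt(1) herm idem comm e by (auto simp del: insert_iff)
qed

section \<open>From maximal information to unbiasedness\<close>

lemma Z2_power_carrier: "carrier (Z2_power m) = Pi\<^sub>E {..<m} (\<lambda>_. {0, 1})"
proof -
  have "{0..<2 :: int} = {0, 1}" by auto
  then show ?thesis by (simp add: Z2_power_def product_group_def integer_mod_group_def)
qed

text \<open>The projector of the certain outcome lies below each of its factors, so a generator that
  fails to commute with \<open>Q\<close> has expectation \<plusminus>1. The bound
  \<open>expval_anticommuting\<close> then leaves 0 for \<open>Q\<close>.\<close>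

lemma maximal_information_anticommuting:
  assumes A: "abelian_pauli_subgroup n A" "independent_generators n A Ps"
    and B: "abelian_pauli_subgroup n B" "Q \<in> B"
    and noncomm: "\<exists>P\<in>A. P * Q \<noteq> Q * P"
    and \<rho>: "\<rho> \<in> density_ops n" "maximal_information n Ps \<rho>"
  shows "expval \<rho> Q = 0"
proof -
  let ?d = "2 ^ n :: nat"
  have Ps: "set Ps \<subseteq> A" and gen: "generate (pauli_group n) (set Ps) = A"
    using A(2) by (auto simp: independent_generators_def)
  note Q = abelian_pauli_subgroup_elt[OF B]
  obtain P where P: "P \<in> set Ps" "P * Q \<noteq> Q * P"
    using generate_commute[OF Ps A(1) Q(1)] noncomm gen by blast
  then have PA: "P \<in> A" using Ps by auto
  note P' = abelian_pauli_subgroup_elt[OF A(1) PA]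
  have anti: "P * Q = (- 1) \<cdot>\<^sub>m (Q * P)"
    by (rule abelian_pauli_subgroup_anticommute[OF A(1) PA B P(2)])
  \<comment> \<open>\<open>x\<close> is the certain outcome, and \<open>e k\<close> below is the
    eigenvalue that generator \<open>k\<close> takes in it.\<close>
  obtain x where "outcome_prob n Ps \<rho> x = 1"
    using \<rho>(2) by (auto simp: maximal_information_def)
  define e :: "nat \<Rightarrow> complex" where "e k = (- 1) ^ nat (x k)" for k
  have e: "e k \<in> {1, - 1}" for k by (cases "even (nat (x k))") (auto simp: e_def)
  let ?Es = "map (\<lambda>k. eigenproj ?d (e k) (Ps ! k)) [0..<length Ps]"
  obtain k where k: "k < length Ps" "Ps ! k = P" using P(1) by (auto simp: in_set_conv_nth)
  have one: "expval \<rho> (foldr (*) ?Es (1\<^sub>m ?d)) = 1"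
    using \<open>outcome_prob n Ps \<rho> x = 1\<close> by (simp add: outcome_prob_def expval_def outcome_proj_eigenproj e_def)
  have "Re (expval \<rho> (foldr (*) ?Es (1\<^sub>m ?d))) \<le> Re (expval \<rho> (eigenproj ?d (e k) P))"
    using k by (intro expval_projection_mono[OF \<rho>(1) refl] eigenproj_commuting_projections[OF A(1) Ps] e) auto
  also have "expval \<rho> (eigenproj ?d (e k) P) = 1 / 2 * (1 + e k * expval \<rho> P)"
    using P'(1) by (simp add: eigenproj_def expval_smult[OF \<rho>(1) refl] expval_add[OF \<rho>(1) refl] expval_one[OF \<rho>(1) refl])
  finally have "1 \<le> Re (e k * expval \<rho> P)" by (simp add: one)
  then have "1 \<le> (Re (expval \<rho> P))\<^sup>2"
    using e[of k] by (auto simp: abs_le_square_iff[of 1, simplified, symmetric])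
  moreover have "(Re (expval \<rho> P))\<^sup>2 + (Re (expval \<rho> Q))\<^sup>2 \<le> 1"
    by (rule expval_anticommuting[OF \<rho>(1) refl P' Q anti])
  ultimately have "(Re (expval \<rho> Q))\<^sup>2 \<le> 0" by linarith
  then have "Re (expval \<rho> Q) = 0" by simp
  then show ?thesis using expval_hermitian_real[OF \<rho>(1) refl Q(1,2)] by (simp add: complex_eq_iff)
qed

text \<open>Expanding the leftmost factor of the product gives half the sum of two terms. In the
  first claim they have prefactors \<open>Q\<close> and \<open>Q * P\<close>, both outside the group
  generated by the rest of the list. In the second, the term with \<open>P\<close> vanishes by the
  first claim, so each factor contributes 1/2, whatever its \<open>e\<close>.\<close>

lemma expval_eigenproj_product:
  assumes B: "abelian_pauli_subgroup n B" and \<rho>: "\<rho> \<in> density_ops n"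
    and van: "\<And>Q. Q \<in> B \<Longrightarrow> Q \<noteq> 1\<^sub>m (2 ^ n) \<Longrightarrow> expval \<rho> Q = 0"
    and zs: "snd ` set zs \<subseteq> B"
  defines "R \<equiv> \<lambda>zs. foldr (*) (map (\<lambda>(e, P). eigenproj (2 ^ n) e P) zs) (1\<^sub>m (2 ^ n))"
  shows "Q \<in> B \<Longrightarrow> Q \<notin> generate (pauli_group n) (snd ` set zs) \<Longrightarrow> expval \<rho> (Q * R zs) = 0"
    and "distinct (map snd zs) \<Longrightarrow>
      \<forall>P\<in>snd ` set zs. P \<notin> generate (pauli_group n) (snd ` set zs - {P}) \<Longrightarrow>
      expval \<rho> (R zs) = 1 / 2 ^ length zs"
proof -
  let ?G = "pauli_group n" and ?d = "2 ^ n :: nat"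
  interpret group ?G by (rule group_pauli_group)
  have sub: "subgroup B ?G" using B by (simp add: abelian_pauli_subgroup_def)
  note elt = abelian_pauli_subgroup_elt[OF B]
  have BG: "B \<subseteq> carrier ?G" using subgroup.subset[OF sub] .
  have R_carrier: "R zs \<in> carrier_mat ?d ?d" if "snd ` set zs \<subseteq> B" for zs
    unfolding R_def using that elt(1) by (intro foldr_mult_carrier) auto
  have R_Cons: "R ((e, P) # zs) = eigenproj ?d e P * R zs" for e P zs by (simp add: R_def)
  have closed: "P * Q \<in> B" if "P \<in> B" "Q \<in> B" for P Q
    using subgroup.m_closed[OF sub that] by (simp add: pauli_group_simps)
  note ev = expval_smult[OF \<rho> refl] expval_add[OF \<rho> refl]
  have a: "expval \<rho> (Q * R zs) = 0" if "snd ` set zs \<subseteq> B" "Q \<in> B" "Q \<notin> generate ?G (snd ` set zs)" for Q zs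
    using that
  proof (induction zs arbitrary: Q)
    case Nil
    \<comment> \<open>The generated group contains the identity, so \<open>Q\<close> differs from it
      and \<open>van\<close> applies.\<close>
    then have "Q \<noteq> 1\<^sub>m ?d" using generate.one[of ?G "{}"] by (auto simp: pauli_group_simps)
    then show ?case using van[OF Nil(2)] elt(1)[OF Nil(2)] by (simp add: R_def)
  next
    case (Cons z zs)
    obtain e P where z: "z = (e, P)" by (cases z)
    have P: "P \<in> B" and zs: "snd ` set zs \<subseteq> B" using Cons.prems z by auto
    note [simp] = elt(1)[OF P] elt(1)[OF Cons.prems(2)] R_carrier[OF zs] mult_carrier_mat[of _ ?d ?d _ ?d]
    have mono: "generate ?G (snd ` set zs) \<subseteq> generate ?G (snd ` set (z # zs))"
      using Cons.prems(1) BG by (intro mono_generate) auto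
    \<comment> \<open>Since \<open>P\<close> is an involution, multiplying by \<open>P\<close> once
      more would put \<open>Q\<close> into the larger group.\<close>
    have "Q * P \<notin> generate ?G (snd ` set zs)"
    proof
      assume "Q * P \<in> generate ?G (snd ` set zs)"
      then have "Q * P \<in> generate ?G (snd ` set (z # zs))" using mono by blast
      moreover have "P \<in> generate ?G (snd ` set (z # zs))" using z by (intro generate.incl) simp
      ultimately have "Q * P \<otimes>\<^bsub>?G\<^esub> P \<in> generate ?G (snd ` set (z # zs))"
        by (rule generate.eng)
      moreover have "Q * P \<otimes>\<^bsub>?G\<^esub> P = Q"
        using elt(3)[OF P]
        by (simp add: pauli_group_simps assoc_mult_mat[of _ ?d ?d _ ?d _ ?d] right_mult_one_mat[of _ ?d ?d])
      ultimately show False using Cons.prems(3) by simp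
    qed
    then have 1: "expval \<rho> (Q * P * R zs) = 0"
      using Cons.IH[OF zs closed[OF Cons.prems(2) P]] by simp
    have 2: "expval \<rho> (Q * R zs) = 0"
      using Cons.IH[OF zs Cons.prems(2)] Cons.prems(3) mono by auto
    have "Q * R (z # zs) = (1 / 2) \<cdot>\<^sub>m (Q * R zs + e \<cdot>\<^sub>m (Q * P * R zs))"
      by (simp add: z R_Cons eigenproj_mult mult_smult_distrib[of _ ?d ?d _ ?d] mult_add_distrib_mat[of _ ?d ?d _ ?d]
          assoc_mult_mat[of _ ?d ?d _ ?d _ ?d])
    then show ?case using 1 2 by (simp add: ev)
  qed
  then show "Q \<in> B \<Longrightarrow> Q \<notin> generate ?G (snd ` set zs) \<Longrightarrow> expval \<rho> (Q * R zs) = 0"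
    using zs by blast
  have "expval \<rho> (R zs) = 1 / 2 ^ length zs"
    if "snd ` set zs \<subseteq> B" "distinct (map snd zs)" "\<forall>P\<in>snd ` set zs. P \<notin> generate ?G (snd ` set zs - {P})" for zs
    using that
  proof (induction zs)
    case Nil
    then show ?case by (simp add: R_def expval_one[OF \<rho> refl])
  next
    case (Cons z zs)
    obtain e P where z: "z = (e, P)" by (cases z)
    have P: "P \<in> B" and zs: "snd ` set zs \<subseteq> B" using Cons.prems z by auto
    note [simp] = elt(1)[OF P] R_carrier[OF zs] mult_carrier_mat[of _ ?d ?d _ ?d]
    \<comment> \<open>Distinctness ensures that removing \<open>P\<close> leaves exactly the
      generators of the tail, so independence makes the first claim applicable to
      \<open>P\<close>.\<close>
    have "snd ` set (z # zs) - {P} = snd ` set zs" using Cons.prems(2) z by auto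
    then have "P \<notin> generate ?G (snd ` set zs)" using Cons.prems(3) z by auto
    then have 1: "expval \<rho> (P * R zs) = 0" by (rule a[OF zs P])
    have "P' \<notin> generate ?G (snd ` set zs - {P'})" if "P' \<in> snd ` set zs" for P'
    proof -
      have "generate ?G (snd ` set zs - {P'}) \<subseteq> generate ?G (snd ` set (z # zs) - {P'})"
        using Cons.prems(1) BG by (intro mono_generate) auto
      then show ?thesis using Cons.prems(3) that by auto
    qed
    then have 2: "expval \<rho> (R zs) = 1 / 2 ^ length zs"
      using Cons.IH zs Cons.prems(2) by auto
    show ?case by (simp add: z R_Cons eigenproj_mult ev 1 2)
  qed
  then show "distinct (map snd zs) \<Longrightarrow>
      \<forall>P\<in>snd ` set zs. P \<notin> generate ?G (snd ` set zs - {P}) \<Longrightarrow>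
      expval \<rho> (R zs) = 1 / 2 ^ length zs"
    using zs by blast
qed

text \<open>Every nontrivial element of \<open>B\<close> has expectation 0, so only the identity
  term of the expanded outcome projector survives, with the same weight for every outcome.\<close>

lemma maximal_information_imp_unbiased:
  assumes A: "abelian_pauli_subgroup n A" "independent_generators n A Ps"
    and B: "abelian_pauli_subgroup n B" "independent_generators n B Qs"
    and noncomm: "\<And>Q. Q \<in> B \<Longrightarrow> Q \<noteq> 1\<^sub>m (2 ^ n) \<Longrightarrow> \<exists>P\<in>A. P * Q \<noteq> Q * P"
    and \<rho>: "\<rho> \<in> density_ops n" "maximal_information n Ps \<rho>"
  shows "unbiased n Qs \<rho>"
  unfolding unbiased_def
proof
  fix x :: "nat \<Rightarrow> int"
  define zs where "zs = map (\<lambda>k. ((- 1) ^ nat (x k) :: complex, Qs ! k)) [0..<length Qs]"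
  have snd_zs: "map snd zs = Qs" by (simp add: zs_def comp_def map_nth)
  then have set_zs: "snd ` set zs = set Qs" by (metis set_map)
  have "expval \<rho> (foldr (*) (map (\<lambda>(e, P). eigenproj (2 ^ n) e P) zs) (1\<^sub>m (2 ^ n))) = 1 / 2 ^ length zs"
  proof (rule expval_eigenproj_product(2)[OF B(1) \<rho>(1)])
    show "expval \<rho> Q = 0" if "Q \<in> B" "Q \<noteq> 1\<^sub>m (2 ^ n)" for Q
      by (rule maximal_information_anticommuting[OF A B(1) that(1) noncomm[OF that] \<rho>])
  qed (use B(2) in \<open>auto simp: set_zs snd_zs independent_generators_def\<close>)
  then show "outcome_prob n Qs \<rho> x = 1 / 2 ^ length Qs"
    by (simp add: outcome_prob_def outcome_proj_eigenproj expval_def zs_def comp_def)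
qed

lemma complementaryI:
  assumes "abelian_pauli_subgroup n A" "abelian_pauli_subgroup n B"
    and "\<And>Q. Q \<in> B \<Longrightarrow> Q \<noteq> 1\<^sub>m (2 ^ n) \<Longrightarrow> \<exists>P\<in>A. P * Q \<noteq> Q * P"
    and "\<And>P. P \<in> A \<Longrightarrow> P \<noteq> 1\<^sub>m (2 ^ n) \<Longrightarrow> \<exists>Q\<in>B. Q * P \<noteq> P * Q"
  shows "complementary n A B"
  unfolding complementary_def
  using maximal_information_imp_unbiased[OF assms(1) _ assms(2) _ assms(3)]
    maximal_information_imp_unbiased[OF assms(2) _ assms(1) _ assms(4)] by blast

section \<open>The field with \<open>2 ^ n\<close> elements and its trace form\<close>

lemma bit_add_self [simp]: "(a :: bit) + a = 0"
  by (cases a) auto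

lemma CHAR_bit [simp]: "CHAR(bit) = 2"
  by (rule CHAR_eq_posI) (auto simp: less_2_cases_iff)

lemma alg_closure_bit_two [simp]: "(2 :: bit alg_closure) = 0"
  using of_nat_CHAR[where ?'a = "bit alg_closure"] by simp

lemma alg_closure_bit_add_self [simp]: "(x :: bit alg_closure) + x = 0"
  by (simp flip: mult_2)

lemma alg_closure_bit_add_left_self [simp]: "(x :: bit alg_closure) + (x + y) = y"
  by (simp flip: add.assoc)

lemma alg_closure_bit_add_eq_0_iff [simp]: "(x :: bit alg_closure) + y = 0 \<longleftrightarrow> x = y"
  by (metis add_left_cancel alg_closure_bit_add_self)

lemma alg_closure_bit_power_add:
  "(x + y :: bit alg_closure) ^ 2 ^ n = x ^ 2 ^ n + y ^ 2 ^ n"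
  by (rule freshmans_dream'[where n = n]) auto

lemma alg_closure_bit_power_sum:
  "(\<Sum>i\<in>I. f i :: bit alg_closure) ^ 2 ^ n = (\<Sum>i\<in>I. f i ^ 2 ^ n)"
  by (rule freshmans_dream_sum'[where n = n]) auto

lemma to_ac_bit_power_2_power: "to_ac (b :: bit) ^ 2 ^ n = to_ac b"
  by (cases b) auto

text \<open>A repeated linear factor would make the derivative vanish at its root. Hence the
  multiset of roots in the full factorisation is a set.\<close>

lemma card_roots_separable:
  fixes p :: "'a :: alg_closed_field poly"
  assumes sep: "\<And>x. poly (pderiv p) x \<noteq> 0"
  shows "card {x. poly p x = 0} = degree p"
proof -
  have p: "p \<noteq> 0" using sep by auto
  obtain A l where A: "size A = degree p" "p = smult l (\<Prod>x\<in>#A. [:-x, 1:])"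
    using alg_closed_imp_factorization[OF p] by blast
  have roots: "set_mset A = {x. poly p x = 0}"
    using p by (auto simp: A(2) poly_prod_mset)
  have le: "count A a \<le> 1" for a
  proof (rule ccontr)
    assume "\<not> count A a \<le> 1"
    then have "replicate_mset 2 a \<subseteq># A" by (simp flip: count_le_replicate_mset_subset_eq)
    then obtain B where "A = add_mset a (add_mset a B)"
      by (auto simp: mset_subset_eq_exists_conv numeral_2_eq_2)
    then have "p = [:-a, 1:] * ([:-a, 1:] * smult l (\<Prod>x\<in>#B. [:-x, 1:]))"
      by (simp add: A(2) del: mult_pCons_left mult_pCons_right)
    then have "poly (pderiv p) a = 0"
      by (simp add: pderiv_smult pderiv_mult del: mult_pCons_left mult_pCons_right)
    with sep show False by blast
  qed
  have count: "count A a = count (mset_set (set_mset A)) a" for a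
  proof (cases "a \<in># A")
    case True
    then have "count A a = 1" using le[of a] by (simp flip: count_greater_zero_iff)
    with True show ?thesis by simp
  qed (simp add: not_in_iff)
  have "A = mset_set (set_mset A)"
    by (rule multiset_eqI) (rule count)
  then show ?thesis using A(1) roots by (metis size_mset_set)
qed

text \<open>Fixed points of an iterated Frobenius map in the algebraic closure of the two-element
  field: all \<open>n\<close> share one type, and closure under the field operations reduces to
  power identities.\<close>

definition gf :: "nat \<Rightarrow> bit alg_closure set" where
  "gf n = {x. x ^ 2 ^ n = x}"

text \<open>The absolute trace as the sum of the Frobenius conjugates; on \<open>gf n\<close> its
  values lie in the prime field by \<open>to_ac_gf_tr\<close>.\<close>

definition gf_trace :: "nat \<Rightarrow> bit alg_closure \<Rightarrow> bit alg_closure" where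
  "gf_trace n x = (\<Sum>i<n. x ^ 2 ^ i)"

lemma gf_0: "0 \<in> gf n" and gf_1: "1 \<in> gf n"
  by (auto simp: gf_def)

lemma gf_add: "x \<in> gf n \<Longrightarrow> y \<in> gf n \<Longrightarrow> x + y \<in> gf n"
  by (simp add: gf_def alg_closure_bit_power_add)

lemma gf_mult: "x \<in> gf n \<Longrightarrow> y \<in> gf n \<Longrightarrow> x * y \<in> gf n"
  by (simp add: gf_def power_mult_distrib)

lemma gf_divide: "x \<in> gf n \<Longrightarrow> y \<in> gf n \<Longrightarrow> x / y \<in> gf n"
  by (simp add: gf_def power_divide)

lemma gf_power: "x \<in> gf n \<Longrightarrow> x ^ k \<in> gf n"
  by (simp add: gf_def flip: power_mult) (metis mult.commute power_mult)

lemma gf_to_ac: "to_ac b \<in> gf n"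
  by (simp add: gf_def to_ac_bit_power_2_power)

lemma gf_sum: "(\<And>i. i \<in> I \<Longrightarrow> f i \<in> gf n) \<Longrightarrow> sum f I \<in> gf n"
  by (induction I rule: infinite_finite_induct) (auto simp: gf_0 gf_add)

lemma gf_trace_0 [simp]: "gf_trace n 0 = 0"
  by (simp add: gf_trace_def)

lemma gf_trace_add: "gf_trace n (x + y) = gf_trace n x + gf_trace n y"
  by (simp add: gf_trace_def alg_closure_bit_power_add sum.distrib)

lemma gf_trace_scale: "gf_trace n (to_ac b * x) = to_ac b * gf_trace n x"
  by (simp add: gf_trace_def power_mult_distrib to_ac_bit_power_2_power sum_distrib_left)

text \<open>Squaring shifts the conjugates cyclically, since \<open>x ^ 2 ^ n = x\<close>.\<close>

lemma gf_trace_square: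
  assumes "x \<in> gf n" shows "gf_trace n (x\<^sup>2) = gf_trace n x"
proof (cases n)
  case (Suc m)
  have "gf_trace n (x\<^sup>2) = (\<Sum>i<n. x ^ 2 ^ Suc i)"
    by (simp add: gf_trace_def flip: power_mult)
  also have "\<dots> = (\<Sum>i<m. x ^ 2 ^ Suc i) + x ^ 2 ^ n"
    by (simp add: Suc)
  also have "\<dots> = gf_trace n x"
    using assms by (simp add: gf_trace_def Suc gf_def sum.lessThan_Suc_shift del: sum.lessThan_Suc power_Suc)
  finally show ?thesis .
qed (simp add: gf_trace_def)

definition gf_tr :: "nat \<Rightarrow> bit alg_closure \<Rightarrow> bit" where
  "gf_tr n x = of_ac (gf_trace n x)"

text \<open>On \<open>gf n\<close> the trace equals its own square, hence is a root of X (X + 1),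
  and \<open>of_ac\<close> loses nothing.\<close>

lemma to_ac_gf_tr:
  assumes "x \<in> gf n" shows "to_ac (gf_tr n x) = gf_trace n x"
proof -
  have "(gf_trace n x)\<^sup>2 = gf_trace n (x\<^sup>2)"
    using alg_closure_bit_power_sum[of "\<lambda>i. x ^ 2 ^ i" "{..<n}" 1]
    by (simp add: gf_trace_def mult.commute flip: power_mult)
  then have "gf_trace n x * (gf_trace n x + 1) = 0"
    by (simp only: gf_trace_square[OF assms] distrib_left power2_eq_square[symmetric]
        mult_1_right alg_closure_bit_add_self)
  then have "gf_trace n x = to_ac 0 \<or> gf_trace n x = to_ac 1"
    by auto
  then show ?thesis by (auto simp: gf_tr_def simp del: to_ac_0 to_ac_1)
qed

lemma gf_tr_0 [simp]: "gf_tr n 0 = 0"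
  by (simp add: gf_tr_def)

lemma gf_tr_add: "x \<in> gf n \<Longrightarrow> y \<in> gf n \<Longrightarrow> gf_tr n (x + y) = gf_tr n x + gf_tr n y"
  by (simp add: to_ac_gf_tr gf_add gf_trace_add flip: to_ac_eq_iff)

lemma gf_tr_scale: "x \<in> gf n \<Longrightarrow> gf_tr n (to_ac b * x) = b * gf_tr n x"
  by (simp add: to_ac_gf_tr gf_mult gf_to_ac gf_trace_scale flip: to_ac_eq_iff)

lemma gf_tr_square: "x \<in> gf n \<Longrightarrow> gf_tr n (x\<^sup>2) = gf_tr n x"
  by (simp add: gf_tr_def gf_trace_square)

lemma gf_tr_sum:
  "(\<And>i. i \<in> I \<Longrightarrow> f i \<in> gf n) \<Longrightarrow> gf_tr n (sum f I) = (\<Sum>i\<in>I. gf_tr n (f i))"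
  by (induction I rule: infinite_finite_induct) (auto simp: gf_tr_add gf_sum)

section \<open>Cardinality of the field and nondegeneracy of its trace form\<close>

context
  fixes n :: nat
  assumes n: "n \<ge> 1"
begin

text \<open>The elements are the roots of X^(2^n) + X, whose derivative is 1 in characteristic two.
  This uses \<open>n \<ge> 1\<close>, for \<open>gf 0\<close> is the whole closure.\<close>

lemma card_gf: "card (gf n) = 2 ^ n"
proof -
  define p :: "bit alg_closure poly" where "p = monom 1 (2 ^ n) + monom 1 1"
  have gt: "(1 :: nat) < 2 ^ n" using n by (intro one_less_power) auto
  have "pderiv p = 1"
    using n by (simp add: p_def pderiv_add pderiv_monom power_0_left one_pCons monom_0)
  then have "card {x. poly p x = 0} = degree p"
    by (intro card_roots_separable) simp
  also have "degree p = 2 ^ n"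
    unfolding p_def using gt by (subst degree_add_eq_left) (auto simp: degree_monom_eq)
  also have "{x. poly p x = 0} = gf n"
    by (auto simp: p_def gf_def poly_monom)
  finally show ?thesis .
qed

lemma finite_gf: "finite (gf n)"
  using card_gf by (metis card.infinite power_not_zero zero_neq_numeral)

text \<open>The trace is given by a polynomial of degree at most 2^(n-1), too small for it to vanish
  at all 2^n elements.\<close>

lemma gf_tr_surj: obtains d where "d \<in> gf n" "gf_tr n d = 1"
proof -
  define p :: "bit alg_closure poly" where "p = (\<Sum>i<n. monom 1 (2 ^ i))"
  have deg: "degree p \<le> 2 ^ (n - 1)"
    unfolding p_def by (intro degree_sum_le) (auto intro!: order.trans[OF degree_monom_le])
  \<comment> \<open>Only the summand i = n - 1 contributes to this coefficient, so the polynomial is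
    not zero.\<close>
  have "coeff p (2 ^ (n - 1)) = (\<Sum>i<n. if i = n - 1 then 1 else 0)"
    by (simp add: p_def coeff_sum)
  also have "\<dots> = 1"
    using n by (subst sum.delta) auto
  finally have "p \<noteq> 0" by auto
  have "card {x. poly p x = 0} \<le> degree p"
    using \<open>p \<noteq> 0\<close> by (rule card_poly_roots_bound)
  also note deg
  also have "(2::nat) ^ (n - 1) < 2 ^ n" using n by simp
  finally have "card {x. poly p x = 0} < card (gf n)" by (simp add: card_gf)
  then have "\<not> gf n \<subseteq> {x. poly p x = 0}"
    using card_mono[OF poly_roots_finite[OF \<open>p \<noteq> 0\<close>], of "gf n"] by linarith
  then obtain d where d: "d \<in> gf n" "poly p d \<noteq> 0" by blast
  then have "to_ac (gf_tr n d) \<noteq> 0"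
    by (simp add: to_ac_gf_tr gf_trace_def p_def poly_sum poly_monom)
  then have "gf_tr n d = 1" by simp
  with d that show ?thesis by blast
qed

text \<open>Multiples of a nonzero \<open>a\<close> exhaust the field, so they include an element of
  trace 1.\<close>

lemma gf_tr_nondegenerate:
  assumes a: "a \<in> gf n" "\<And>b. b \<in> gf n \<Longrightarrow> gf_tr n (a * b) = 0"
  shows "a = 0"
proof (rule ccontr)
  assume "a \<noteq> 0"
  obtain d where d: "d \<in> gf n" "gf_tr n d = 1" by (rule gf_tr_surj)
  show False using a(2)[of "d / a"] a(1) d \<open>a \<noteq> 0\<close> by (simp add: gf_divide)
qed

text \<open>Translation by an element of trace 1 exchanges the two fibres of the trace.\<close>

lemma card_gf_tr_kernel: "card {x \<in> gf n. gf_tr n x = 0} = 2 ^ (n - 1)"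
proof -
  let ?H = "{x \<in> gf n. gf_tr n x = 0}" and ?H' = "{x \<in> gf n. gf_tr n x = 1}"
  obtain d where d: "d \<in> gf n" "gf_tr n d = 1" by (rule gf_tr_surj)
  have "bij_betw (\<lambda>x. x + d) ?H ?H'"
    by (rule bij_betwI[where g = "\<lambda>x. x + d"]) (auto simp: d gf_add gf_tr_add add.assoc)
  then have "card ?H = card ?H'" by (rule bij_betw_same_card)
  moreover have "card (gf n) = card ?H + card ?H'"
    using finite_gf by (subst card_Un_disjoint[symmetric]) (auto intro!: arg_cong[where f = card])
  ultimately have "2 * card ?H = 2 ^ n" by (simp add: card_gf)
  then show ?thesis using n by (cases n) auto
qed

end

text \<open>The norm \<open>s\<^sup>2 + s t + d t\<^sup>2\<close> of the quadratic extension by a root of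
  \<open>\<theta>\<^sup>2 + \<theta> = d\<close>; its unit circle has \<open>2 ^ n + 1\<close> points.\<close>

definition gf_circle :: "nat \<Rightarrow> bit alg_closure \<Rightarrow> (bit alg_closure \<times> bit alg_closure) set" where
  "gf_circle n d = {(s, t). s \<in> gf n \<and> t \<in> gf n \<and> s\<^sup>2 + s * t + d * t\<^sup>2 = 1}"

text \<open>The points arise by scaling (1, 0) and the vectors (s, 1), one for each of the 2^n + 1
  directions of the plane, to norm 1. Scaling is possible because the norm is anisotropic and every
  field element has a square root.\<close>

lemma gf_circle_param:
  assumes n: "n \<ge> 1" and d: "d \<in> gf n" "gf_tr n d = 1"
  obtains f :: "nat \<Rightarrow> bit alg_closure \<times> bit alg_closure"
  where "f ` {1..2 ^ n + 1} \<subseteq> gf_circle n d" "inj_on f {1..2 ^ n + 1}"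
proof -
  define N where "N s = s\<^sup>2 + s + d" for s
  \<comment> \<open>The inverse square root of \<open>N s\<close>: on the field, the power 2^(n-1)
    inverts squaring.\<close>
  define r where "r s = (1 / N s) ^ 2 ^ (n - 1)" for s
  have N: "N s \<in> gf n" "N s \<noteq> 0" if "s \<in> gf n" for s
  proof -
    show "N s \<in> gf n" using that d by (simp add: N_def gf_add gf_power)
    \<comment> \<open>The traces of s^2 and s cancel, which leaves the trace of
      \<open>d\<close>.\<close>
    have "gf_tr n (N s) = 1"
      using that d by (simp add: N_def gf_tr_add gf_tr_square gf_add gf_power)
    then show "N s \<noteq> 0" by auto
  qed
  have r: "r s \<in> gf n" "r s \<noteq> 0" "(r s)\<^sup>2 * N s = 1" if "s \<in> gf n" for s
  proof -
    have N': "1 / N s \<in> gf n" using N that by (intro gf_divide gf_1)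
    then show "r s \<in> gf n" by (simp add: r_def gf_power)
    show "r s \<noteq> 0" using N that by (simp add: r_def)
    have "(r s)\<^sup>2 = (1 / N s) ^ 2 ^ n"
      unfolding r_def power_mult[symmetric] using n by (cases n) (auto simp: mult.commute)
    also have "\<dots> = 1 / N s" using N' by (simp add: gf_def)
    finally show "(r s)\<^sup>2 * N s = 1" using N that by simp
  qed
  \<comment> \<open>\<open>None\<close> stands for the direction (1, 0) and \<open>Some s\<close>
    for (s, 1); the nonzero second coordinate \<open>r s\<close> tells them apart and recovers
    \<open>s\<close>.\<close>
  define g where "g = case_option (1, 0) (\<lambda>s. (s * r s, r s))"
  let ?D = "insert None (Some ` gf n)"
  have "g x \<in> gf_circle n d" if "x \<in> ?D" for x
  proof (cases x)
    case (Some s)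
    then have s: "s \<in> gf n" using that by auto
    have "(s * r s)\<^sup>2 + s * r s * r s + d * (r s)\<^sup>2 = (r s)\<^sup>2 * N s"
      by (simp add: N_def power2_eq_square algebra_simps)
    then show ?thesis using r[OF s] s Some by (simp add: g_def gf_circle_def gf_mult)
  qed (simp add: g_def gf_circle_def gf_0 gf_1)
  moreover have "inj_on g ?D"
  proof (rule inj_onI)
    fix x y assume "x \<in> ?D" "y \<in> ?D" "g x = g y"
    then show "x = y" using r(2) by (auto simp: g_def)
  qed
  moreover have "card {1..2 ^ n + 1 :: nat} = card ?D"
    using finite_gf[OF n] by (simp add: card_image card_gf[OF n])
  then obtain h where h: "bij_betw h {1..2 ^ n + 1 :: nat} ?D"
    using finite_same_card_bij[of "{1..2 ^ n + 1 :: nat}" ?D] finite_gf[OF n] by auto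
  ultimately show ?thesis
    by (intro that[of "g \<circ> h"])
      (unfold bij_betw_def image_comp[symmetric], auto intro!: comp_inj_on)
qed

text \<open>\<open>T\<close> is the symplectic form of the two points. Dividing the norm equation by
  \<open>T\<^sup>2\<close> writes (1/T)^2 as \<open>d\<close> plus an element of the form y^2 + y,
  whose trace is 0.\<close>

lemma gf_circle_distinct:
  assumes d: "d \<in> gf n" "gf_tr n d = 1"
    and u: "(s, t) \<in> gf_circle n d" and v: "(s', t') \<in> gf_circle n d" and ne: "(s, t) \<noteq> (s', t')"
  defines "T \<equiv> s * t' + t * s'"
  shows "T \<in> gf n" "T \<noteq> 0" "gf_tr n (1 / T) = 1"
proof -
  have mem: "s \<in> gf n" "t \<in> gf n" "s' \<in> gf n" "t' \<in> gf n"
    and Nu: "s\<^sup>2 + s * t + d * t\<^sup>2 = 1" and Nv: "s'\<^sup>2 + s' * t' + d * t'\<^sup>2 = 1"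
    using u v by (auto simp: gf_circle_def)
  \<comment> \<open>\<open>q + T \<theta>\<close> is the product of \<open>s + t \<theta>\<close> and the conjugate of \<open>s' + t' \<theta>\<close>.\<close>
  define q where "q = s * s' + s * t' + d * t * t'"
  show T: "T \<in> gf n" using mem by (simp add: T_def gf_add gf_mult)
  have q_in: "q \<in> gf n" using mem d by (simp add: q_def gf_add gf_mult)
  have "(s\<^sup>2 + s * t + d * t\<^sup>2) * (s'\<^sup>2 + s' * t' + d * t'\<^sup>2) = q\<^sup>2 + q * T + d * T\<^sup>2"
    by (simp add: q_def T_def power2_eq_square algebra_simps)
  then have norm: "q\<^sup>2 + q * T + d * T\<^sup>2 = 1" by (simp add: Nu Nv)
  show T0: "T \<noteq> 0"
  proof
    assume T0: "T = 0"
    then have "(q + 1) * (q + 1) = 0"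
      using norm by (simp add: algebra_simps power2_eq_square)
    then have q1: "q = 1" by simp
    \<comment> \<open>Multiplying q + T\<theta> by s' + t'\<theta> recovers s + t\<theta>, as the
      second point has norm 1. The identities for \<open>s\<close> and \<open>t\<close> are the two
      coordinates of this; with q = 1 and T = 0 they identify the points.\<close>
    have "s * (s'\<^sup>2 + s' * t' + d * t'\<^sup>2) = q * s' + d * t' * T"
      by (simp add: q_def T_def power2_eq_square algebra_simps)
    then have "s = s'" by (simp add: Nv T0 q1)
    moreover have "t * (s'\<^sup>2 + s' * t' + d * t'\<^sup>2) = q * t' + (s' + t') * T"
      by (simp add: q_def T_def power2_eq_square algebra_simps)
    then have "t = t'" by (simp add: Nv T0 q1)
    ultimately show False using ne by simp
  qed
  have "(1 / T)\<^sup>2 = (q\<^sup>2 + q * T + d * T\<^sup>2) / T\<^sup>2" by (simp add: norm power_divide)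
  also have "\<dots> = (q / T)\<^sup>2 + q / T + d"
    using T0 by (simp add: field_simps power2_eq_square)
  finally have "gf_tr n ((1 / T)\<^sup>2) = 1"
    using q_in T d by (simp add: gf_tr_add gf_tr_square gf_add gf_divide gf_power)
  then show "gf_tr n (1 / T) = 1"
    using gf_tr_square[of "1 / T" n] T by (simp add: gf_divide gf_1)
qed

text \<open>Only 0 and 1 are orthogonal to all trace zero elements. If \<open>a * T\<close> were one
  of them, \<open>a\<close> would be 0 or 1/T, but \<open>a\<close> is nonzero and 1/T has trace
  1.\<close>

lemma gf_tr_pairing_nondegenerate:
  assumes n: "n \<ge> 1" and T: "T \<in> gf n" "T \<noteq> 0" "gf_tr n (1 / T) = 1"
    and a: "a \<in> gf n" "gf_tr n a = 0" "a \<noteq> 0"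
  obtains b where "b \<in> gf n" "gf_tr n b = 0" "gf_tr n (a * b * T) = 1"
proof (rule ccontr)
  note witness = that
  assume no: "\<not> thesis"
  have van: "gf_tr n (a * T * b) = 0" if "b \<in> gf n" "gf_tr n b = 0" for b
    using no that witness[of b] by (cases "gf_tr n (a * T * b)") (auto simp: ac_simps)
  obtain e where e: "e \<in> gf n" "gf_tr n e = 1" by (rule gf_tr_surj[OF n])
  \<comment> \<open>The functional b -> tr(aTb) vanishes on the kernel of the trace, so it is a
    multiple of the trace; its value at \<open>e\<close>, where the trace is 1, is the
    multiplier.\<close>
  define k where "k = to_ac (gf_tr n (a * T * e))"
  have k: "k \<in> gf n" by (simp add: k_def gf_to_ac)
  have "gf_tr n ((a * T + k) * b) = 0" if b: "b \<in> gf n" for b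
  proof -
    \<comment> \<open>The projection of \<open>b\<close> to the trace zero elements along
      \<open>e\<close>.\<close>
    define b' where "b' = b + to_ac (gf_tr n b) * e"
    have b': "b' \<in> gf n" "gf_tr n b' = 0"
      using b e by (simp_all add: b'_def gf_add gf_mult gf_to_ac gf_tr_add gf_tr_scale)
    have "gf_tr n (a * T * b') = gf_tr n (a * T * b) + gf_tr n b * gf_tr n (a * T * e)"
      using a T b e gf_tr_scale[of "a * T * e" n "gf_tr n b"]
      by (simp add: b'_def distrib_left gf_tr_add gf_mult gf_to_ac mult.left_commute)
    then have "gf_tr n (a * T * b) = gf_tr n b * gf_tr n (a * T * e)"
      using van[OF b'] by (metis add_left_cancel bit_add_self add.commute)
    then show ?thesis
      using a T b by (simp add: k_def distrib_right gf_tr_add gf_mult gf_to_ac gf_tr_scale)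
  qed
  then have "a * T + k = 0"
    using a T k by (intro gf_tr_nondegenerate[OF n]) (auto simp: gf_add gf_mult)
  then have "a = k * (1 / T)" using T by (simp add: field_simps)
  \<comment> \<open>\<open>k = 0\<close> would give \<open>a = 0\<close>.\<close>
  moreover from this a have "k = 1" by (cases "gf_tr n (a * T * e)") (auto simp: k_def)
  ultimately show False using a T by simp
qed

section \<open>Bases over the two-element field\<close>

definition bit_basis :: "nat \<Rightarrow> (nat \<Rightarrow> bit alg_closure) \<Rightarrow> bit alg_closure set \<Rightarrow> bool" where
  "bit_basis m e H \<longleftrightarrow> (\<forall>i<m. e i \<in> H) \<and> (\<forall>a\<in>H. \<exists>c. a = (\<Sum>i<m. to_ac (c i) * e i)) \<and>
    (\<forall>c. (\<Sum>i<m. to_ac (c i) * e i) = 0 \<longrightarrow> (\<forall>i<m. c i = 0))"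

text \<open>Independent elements are added one at a time: \<open>k\<close> of them span 2^k
  elements, so while k < m some element of \<open>H\<close> lies outside the span. At k = m counting
  makes the span all of \<open>H\<close>.\<close>

lemma bit_basis_exists:
  fixes H :: "bit alg_closure set"
  assumes 0: "0 \<in> H" and add: "\<And>x y. x \<in> H \<Longrightarrow> y \<in> H \<Longrightarrow> x + y \<in> H" and card: "card H = 2 ^ m"
  shows "\<exists>e. bit_basis m e H"
proof -
  have fin: "finite H" using card by (metis card.infinite power_not_zero zero_neq_numeral)
  define S :: "nat \<Rightarrow> (nat \<Rightarrow> bit alg_closure) \<Rightarrow> (nat \<Rightarrow> bit) \<Rightarrow> bit alg_closure"
    where "S k e c = (\<Sum>i<k. to_ac (c i) * e i)" for k e c
  define indep where "indep k e \<longleftrightarrow> (\<forall>i<k. e i \<in> H) \<and> (\<forall>c. S k e c = 0 \<longrightarrow> (\<forall>i<k. c i = 0))" for k e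
  have S_add: "S k e (\<lambda>i. c i + c' i) = S k e c + S k e c'" for k e c c'
    by (simp add: S_def algebra_simps sum.distrib)
  have span: "S k e ` (Pi\<^sub>E {..<k} (\<lambda>_. UNIV)) \<subseteq> H" if "indep k e" for k e
  proof -
    have term_in: "to_ac (c i) * e i \<in> H" if "i < k" for c :: "nat \<Rightarrow> bit" and i
      using that 0 \<open>indep k e\<close> by (cases "c i") (auto simp: indep_def)
    have "(\<Sum>i\<in>I. to_ac (c i) * e i) \<in> H" if "I \<subseteq> {..<k}" for c :: "nat \<Rightarrow> bit" and I
      using finite_subset[OF that finite_lessThan] that
      by (induction I rule: finite_induct) (auto intro: 0 add term_in)
    then show ?thesis by (auto simp: S_def)
  qed
  have UNIV_bit: "UNIV = {0, 1 :: bit}" using bit_not_zero_iff by auto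
  have card_bit: "card (UNIV :: bit set) = 2" unfolding UNIV_bit by simp
  have card_span: "card (S k e ` (Pi\<^sub>E {..<k} (\<lambda>_. UNIV))) = 2 ^ k" if "indep k e" for k e
  proof -
    \<comment> \<open>Coefficient functions are taken extensional on \<open>{..<k}\<close>, so that
      each combination is counted once.\<close>
    have "inj_on (S k e) (Pi\<^sub>E {..<k} (\<lambda>_. UNIV))"
    proof (rule inj_onI)
      fix c c' :: "nat \<Rightarrow> bit"
      assume c: "c \<in> Pi\<^sub>E {..<k} (\<lambda>_. UNIV)" "c' \<in> Pi\<^sub>E {..<k} (\<lambda>_. UNIV)" "S k e c = S k e c'"
      then have "S k e (\<lambda>i. c i + c' i) = 0" by (simp add: S_add)
      then have "\<forall>i<k. c i + c' i = 0"
        using that[unfolded indep_def, THEN conjunct2, THEN spec, of "\<lambda>i. c i + c' i"] by blast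
      then have "\<forall>i<k. c i = c' i" by (metis add_left_cancel bit_add_self)
      with c show "c = c'" by (auto intro: PiE_ext)
    qed
    then show ?thesis by (simp add: card_image card_PiE card_bit)
  qed
  have "\<exists>e. indep k e" if "k \<le> m" for k
    using that
  proof (induction k)
    case 0
    then show ?case by (auto simp: indep_def)
  next
    case (Suc k)
    then obtain e where e: "indep k e" by auto
    have "card (S k e ` (Pi\<^sub>E {..<k} (\<lambda>_. UNIV))) < card H"
      using Suc.prems by (simp add: card_span[OF e] card)
    then obtain h where h: "h \<in> H" "h \<notin> S k e ` (Pi\<^sub>E {..<k} (\<lambda>_. UNIV))"
      using span[OF e] by (metis less_irrefl subset_antisym subsetI)
    have nin: "h \<noteq> S k e c" for c
    proof
      assume "h = S k e c"
      also have "S k e c = S k e (restrict c {..<k})" by (simp add: S_def)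
      finally show False using h(2) by auto
    qed
    have S_Suc: "S (Suc k) (e(k := h)) c = S k e c + to_ac (c k) * h" for c
      by (simp add: S_def)
    have "c i = 0" if c: "S (Suc k) (e(k := h)) c = 0" and i: "i < Suc k" for c i
    proof -
      \<comment> \<open>Otherwise \<open>h\<close> would equal a combination of the earlier
        elements, as signs do not matter in characteristic two.\<close>
      have "c k = 0"
      proof (rule ccontr)
        assume "c k \<noteq> 0"
        then show False using c nin[of c] by (simp add: S_Suc)
      qed
      moreover from this have "S k e c = 0" using c by (simp add: S_Suc)
      ultimately show ?thesis using e i by (auto simp: indep_def less_Suc_eq)
    qed
    then have "indep (Suc k) (e(k := h))"
      using e h(1) by (simp add: indep_def less_Suc_eq)
    then show ?case by blast
  qed
  then obtain e where e: "indep m e" by blast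
  have "S m e ` (Pi\<^sub>E {..<m} (\<lambda>_. UNIV)) = H"
    by (rule card_subset_eq[OF fin span[OF e]]) (simp add: card_span[OF e] card)
  with e show ?thesis by (intro exI[of _ e]) (auto simp: bit_basis_def indep_def S_def)
qed

section \<open>Groups generated by commuting Pauli operators\<close>

text \<open>Commuting as well would make \<open>P * Q\<close> its own negative, hence 0, which is
  impossible for invertible factors.\<close>

lemma not_commute_if_anticommute:
  fixes P Q :: "complex mat"
  assumes "d > 0" "P \<in> carrier_mat d d" "Q \<in> carrier_mat d d" "P * P = 1\<^sub>m d" "Q * Q = 1\<^sub>m d"
    and anti: "P * Q = (- 1) \<cdot>\<^sub>m (Q * P)"
  shows "P * Q \<noteq> Q * P"
proof
  assume eq: "P * Q = Q * P"
  have c: "P * Q \<in> carrier_mat d d" using assms by simp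
  have "P * Q = (- 1) \<cdot>\<^sub>m (P * Q)" using anti eq by simp
  then have "(P * Q) $$ (i, j) = - (P * Q) $$ (i, j)" if "i < d" "j < d" for i j
    using that c by (metis index_smult_mat(1) carrier_matD mult_minus1)
  then have "P * Q = 0\<^sub>m d d" using c by (intro eq_matI) auto
  moreover have "P * (P * Q) = P * P * Q" using assms by (intro assoc_mult_mat[symmetric]) auto
  ultimately have "Q = 0\<^sub>m d d" using assms left_mult_one_mat[of Q d d] right_mult_zero_mat[of P d d d] by metis
  then have "1\<^sub>m d = (0\<^sub>m d d :: complex mat)" using assms by simp
  then have "(1\<^sub>m d :: complex mat) $$ (0, 0) = 0\<^sub>m d d $$ (0, 0)" by simp
  then show False using \<open>d > 0\<close> by simp
qed

lemma smult_smult_mat: "a \<cdot>\<^sub>m (b \<cdot>\<^sub>m M) = (a * b :: 'a :: semigroup_mult) \<cdot>\<^sub>m M"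
  by (rule eq_matI) (auto simp: mult.assoc)

text \<open>The ordered product of the generators selected by \<open>c\<close>, largest index
  leftmost. For commuting involutions it is a homomorphism on bit vectors by
  \<open>word_mult\<close>.\<close>

fun word :: "nat \<Rightarrow> (nat \<Rightarrow> complex mat) \<Rightarrow> nat \<Rightarrow> (nat \<Rightarrow> bit) \<Rightarrow> complex mat" where
  "word d g 0 c = 1\<^sub>m d"
| "word d g (Suc m) c = (if c m = 0 then word d g m c else g m * word d g m c)"

lemma word_carrier: "(\<And>i. i < m \<Longrightarrow> g i \<in> carrier_mat d d) \<Longrightarrow> word d g m c \<in> carrier_mat d d"
  by (induction m) (auto intro: mult_carrier_mat)

lemma word_zero: "(\<And>i. i < m \<Longrightarrow> c i = 0) \<Longrightarrow> word d g m c = 1\<^sub>m d"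
  by (induction m) auto

lemma word_cong: "(\<And>i. i < m \<Longrightarrow> c i = c' i) \<Longrightarrow> word d g m c = word d g m c'"
  by (induction m) auto

lemma word_commute:
  assumes "\<And>i. i < m \<Longrightarrow> g i \<in> carrier_mat d d" "Q \<in> carrier_mat d d"
    and "\<And>i. i < m \<Longrightarrow> Q * g i = g i * Q"
  shows "Q * word d g m c = word d g m c * Q"
  using assms
proof (induction m)
  case (Suc m)
  note [simp] = Suc.prems(2) Suc.prems(1)[of m, simplified] word_carrier[of m g d c, OF Suc.prems(1)]
  note assoc = assoc_mult_mat[of _ d d _ d _ d]
  have IH: "Q * word d g m c = word d g m c * Q" using Suc by auto
  have "Q * (g m * word d g m c) = Q * g m * word d g m c" by (rule assoc[symmetric]) simp_all
  also have "Q * g m = g m * Q" using Suc.prems by simp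
  also have "g m * Q * word d g m c = g m * (Q * word d g m c)" by (rule assoc) simp_all
  also have "\<dots> = g m * word d g m c * Q" unfolding IH by (rule assoc[symmetric]) simp_all
  finally show ?case using IH by simp
qed (simp add: left_mult_one_mat[of _ d d] right_mult_one_mat[of _ d d])

lemma word_mult:
  assumes "\<And>i. i < m \<Longrightarrow> g i \<in> carrier_mat d d" "\<And>i. i < m \<Longrightarrow> g i * g i = 1\<^sub>m d"
    and "\<And>i j. i < m \<Longrightarrow> j < m \<Longrightarrow> g i * g j = g j * g i"
  shows "word d g m c * word d g m c' = word d g m (\<lambda>i. c i + c' i)"
  using assms
proof (induction m)
  case (Suc m)
  let ?w = "word d g m c" and ?w' = "word d g m c'"
  have [simp]: "g m \<in> carrier_mat d d" "?w \<in> carrier_mat d d" "?w' \<in> carrier_mat d d"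
    using Suc.prems(1) by (auto intro: word_carrier)
  note [simp] = mult_carrier_mat[of _ d d _ d]
  note assoc = assoc_mult_mat[of _ d d _ d _ d]
  have IH: "?w * ?w' = word d g m (\<lambda>i. c i + c' i)" using Suc by auto
  have comm: "?w * g m = g m * ?w" using Suc.prems by (intro word_commute[symmetric]) auto
  have 1: "?w * (g m * ?w') = g m * (?w * ?w')"
    by (simp flip: assoc add: comm)
  \<comment> \<open>When both words contain \<open>g m\<close>, its two copies meet and cancel,
    matching 1 + 1 = 0 in the exponent.\<close>
  have 2: "g m * ?w * (g m * ?w') = ?w * ?w'"
  proof -
    have "g m * ?w * (g m * ?w') = g m * (g m * (?w * ?w'))" by (simp add: assoc 1)
    also have "\<dots> = g m * g m * (?w * ?w')" by (simp add: assoc)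
    finally show ?thesis using Suc.prems(2)[of m] by (simp add: left_mult_one_mat[of _ d d])
  qed
  show ?case
    by (cases "c m"; cases "c' m") (simp_all add: IH[symmetric] 1 2 assoc)
qed simp

section \<open>Words in Pauli operators and the symplectic form of their labels\<close>

definition label_form :: "nat \<Rightarrow> (nat \<Rightarrow> bit) \<Rightarrow> (nat \<Rightarrow> bit) \<Rightarrow> (nat \<Rightarrow> bit) \<Rightarrow> (nat \<Rightarrow> bit) \<Rightarrow> bit" where
  "label_form n x z x' z' = (\<Sum>j<n. x j * z' j + z j * x' j)"

text \<open>Labels combine linearly; the phase can stay unspecified because commutation ignores
  it.\<close>

lemma word_pauli:
  obtains e where "e \<in> phases"
    "word (2 ^ n) (\<lambda>i. pauli n (x i) (z i)) m c
      = e \<cdot>\<^sub>m pauli n (\<lambda>j. \<Sum>i<m. c i * x i j) (\<lambda>j. \<Sum>i<m. c i * z i j)"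
proof -
  have "\<exists>e\<in>phases. word (2 ^ n) (\<lambda>i. pauli n (x i) (z i)) m c
      = e \<cdot>\<^sub>m pauli n (\<lambda>j. \<Sum>i<m. c i * x i j) (\<lambda>j. \<Sum>i<m. c i * z i j)"
  proof (induction m)
    case 0
    show ?case by (intro bexI[of _ 1]) (auto simp: pauli_zero phases_def)
  next
    case (Suc m)
    then obtain e where e: "e \<in> phases" "word (2 ^ n) (\<lambda>i. pauli n (x i) (z i)) m c
      = e \<cdot>\<^sub>m pauli n (\<lambda>j. \<Sum>i<m. c i * x i j) (\<lambda>j. \<Sum>i<m. c i * z i j)" by blast
    show ?case
    proof (cases "c m = 0")
      case True
      then show ?thesis using e by auto
    next
      case False
      then have cm: "c m = 1" by simp
      obtain e' where "e' \<in> phases" "pauli n (x m) (z m) * pauli n (\<lambda>j. \<Sum>i<m. c i * x i j) (\<lambda>j. \<Sum>i<m. c i * z i j)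
        = e' \<cdot>\<^sub>m pauli n (\<lambda>j. x m j + (\<Sum>i<m. c i * x i j)) (\<lambda>j. z m j + (\<Sum>i<m. c i * z i j))"
        by (rule pauli_mult)
      then show ?thesis using e cm
        by (intro bexI[of _ "e * e'"])
          (simp_all add: phases_mult mult_smult_distrib[OF pauli_carrier pauli_carrier]
            add.commute smult_smult_mat)
    qed
  qed
  with that show ?thesis by blast
qed

lemma label_form_sum:
  fixes m m' :: nat
  shows
  "label_form n (\<lambda>j. \<Sum>i<m. c i * x i j) (\<lambda>j. \<Sum>i<m. c i * z i j)
      (\<lambda>j. \<Sum>k<m'. c' k * x' k j) (\<lambda>j. \<Sum>k<m'. c' k * z' k j)
    = (\<Sum>i<m. \<Sum>k<m'. c i * c' k * label_form n (x i) (z i) (x' k) (z' k))"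
proof -
  have *: "(\<Sum>j<n. (\<Sum>i<m. c i * f i j) * (\<Sum>k<m'. c' k * g k j))
    = (\<Sum>i<m. \<Sum>k<m'. c i * c' k * (\<Sum>j<n. f i j * g k j))" for f g :: "nat \<Rightarrow> nat \<Rightarrow> bit"
  proof -
    have "(\<Sum>j<n. (\<Sum>i<m. c i * f i j) * (\<Sum>k<m'. c' k * g k j))
      = (\<Sum>j<n. \<Sum>i<m. \<Sum>k<m'. c i * c' k * (f i j * g k j))"
      by (simp add: sum_product ac_simps)
    also have "\<dots> = (\<Sum>i<m. \<Sum>j<n. \<Sum>k<m'. c i * c' k * (f i j * g k j))"
      by (rule sum.swap)
    also have "\<dots> = (\<Sum>i<m. \<Sum>k<m'. \<Sum>j<n. c i * c' k * (f i j * g k j))"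
      by (intro sum.cong refl sum.swap)
    finally show ?thesis by (simp add: sum_distrib_left)
  qed
  show ?thesis
    unfolding label_form_def by (simp add: sum.distrib * distrib_left)
qed

text \<open>The phases of the two words occur on both sides, so only the bilinear form of their
  labels enters the sign.\<close>

lemma word_pauli_commute:
  fixes n :: nat and x z x' z' :: "nat \<Rightarrow> nat \<Rightarrow> bit"
  defines "w \<equiv> word (2 ^ n) (\<lambda>i. pauli n (x i) (z i))" and "w' \<equiv> word (2 ^ n) (\<lambda>i. pauli n (x' i) (z' i))"
  shows "w m c * w' m' c'
    = bit_sign (\<Sum>i<m. \<Sum>k<m'. c i * c' k * label_form n (x i) (z i) (x' k) (z' k)) \<cdot>\<^sub>m (w' m' c' * w m c)"
proof -
  obtain e where e: "w m c = e \<cdot>\<^sub>m pauli n (\<lambda>j. \<Sum>i<m. c i * x i j) (\<lambda>j. \<Sum>i<m. c i * z i j)"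
    unfolding w_def by (rule word_pauli)
  obtain e' where e': "w' m' c' = e' \<cdot>\<^sub>m pauli n (\<lambda>j. \<Sum>i<m'. c' i * x' i j) (\<lambda>j. \<Sum>i<m'. c' i * z' i j)"
    unfolding w'_def by (rule word_pauli)
  show ?thesis
    unfolding e e' smult_mult_smult_mat[OF pauli_carrier pauli_carrier] label_form_sum[symmetric]
    by (subst pauli_commute) (simp add: label_form_def smult_smult_mat ac_simps)
qed

lemma word_pauli_mult:
  fixes n m :: nat and x z :: "nat \<Rightarrow> nat \<Rightarrow> bit"
  defines "w \<equiv> word (2 ^ n) (\<lambda>i. pauli n (x i) (z i)) m"
  assumes iso: "\<And>i j. i < m \<Longrightarrow> j < m \<Longrightarrow> label_form n (x i) (z i) (x j) (z j) = 0"
  shows "w c * w c' = w (\<lambda>i. c i + c' i)" and "w c * w c = 1\<^sub>m (2 ^ n)"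
proof -
  have comm: "pauli n (x i) (z i) * pauli n (x j) (z j) = pauli n (x j) (z j) * pauli n (x i) (z i)"
    if "i < m" "j < m" for i j
    using iso[OF that] pauli_commute[of n "x i" "z i" "x j" "z j"] by (simp add: label_form_def)
  show w_mult: "w c * w c' = w (\<lambda>i. c i + c' i)" for c'
    unfolding w_def by (rule word_mult) (auto simp: pauli_square comm)
  show "w c * w c = 1\<^sub>m (2 ^ n)"
    unfolding w_mult unfolding w_def by (rule word_zero) simp
qed

section \<open>Subgroups from isotropic labels\<close>

lemma of_int_bit_mod_2: "of_int (k mod 2) = (of_int k :: bit)"
proof -
  have "(of_int k :: bit) = of_int (2 * (k div 2) + k mod 2)" by simp
  also have "\<dots> = of_int (k mod 2)" by (simp only: of_int_add of_int_mult) simp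
  finally show ?thesis ..
qed

lemma group_Z2_power: "group (Z2_power m)"
  by (simp add: Z2_power_def)

text \<open>\<open>indep\<close> says that only the empty word is a scalar matrix. For the scalar 1
  this makes distinct words distinct operators, which gives the dimension; for -1 it keeps the
  negative identity out.\<close>

lemma word_pauli_subgroup:
  fixes n m :: nat and x z :: "nat \<Rightarrow> nat \<Rightarrow> bit"
  defines "w \<equiv> word (2 ^ n) (\<lambda>i. pauli n (x i) (z i)) m"
  assumes iso: "\<And>i j. i < m \<Longrightarrow> j < m \<Longrightarrow> label_form n (x i) (z i) (x j) (z j) = 0"
    and indep: "\<And>c e i. w c = e \<cdot>\<^sub>m 1\<^sub>m (2 ^ n) \<Longrightarrow> i < m \<Longrightarrow> c i = 0"
  shows "abelian_pauli_subgroup n (range w)" "has_dimension n (range w) m"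
proof -
  let ?G = "pauli_group n" and ?d = "2 ^ n :: nat"
  interpret group ?G by (rule group_pauli_group)
  have w_mult: "w c * w c' = w (\<lambda>i. c i + c' i)" and w_square: "w c * w c = 1\<^sub>m ?d" for c c'
    unfolding w_def by (rule word_pauli_mult[OF iso]; assumption)+
  have w_zero: "w c = 1\<^sub>m ?d" if "\<And>i. i < m \<Longrightarrow> c i = 0" for c
    unfolding w_def using that by (rule word_zero)
  have w_pauli: "\<exists>e\<in>{1, - 1}. \<exists>x z. w c = e \<cdot>\<^sub>m pauli n x z" for c
  proof -
    obtain e x' z' where e: "w c = e \<cdot>\<^sub>m pauli n x' z'" unfolding w_def by (rule word_pauli)
    \<comment> \<open>Isotropic words square to the identity, which excludes the phases
      \<plusminus>\<i>.\<close>
    have "e * e \<cdot>\<^sub>m 1\<^sub>m ?d = (1\<^sub>m ?d :: complex mat)"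
      using w_square[of c] unfolding e smult_mult_smult_mat[OF pauli_carrier pauli_carrier] pauli_square .
    then have "(e * e \<cdot>\<^sub>m 1\<^sub>m ?d) $$ (0, 0) = (1\<^sub>m ?d :: complex mat) $$ (0, 0)" by simp
    then have "e * e = 1" by simp
    then have "e \<in> {1, - 1}" by (simp add: square_eq_1_iff)
    with e show ?thesis by blast
  qed
  have w_carrier: "w c \<in> carrier ?G" for c
    using w_pauli[of c] unfolding pauli_group_simps phases_def by blast
  have sub: "subgroup (range w) ?G"
  proof (rule subgroupI)
    show "range w \<subseteq> carrier ?G" using w_carrier by blast
    show "range w \<noteq> {}" by simp
    show "inv\<^bsub>?G\<^esub> P \<in> range w" if "P \<in> range w" for P
    proof -
      obtain c where c: "P = w c" using \<open>P \<in> range w\<close> by blast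
      have "inv\<^bsub>?G\<^esub> P = P"
        unfolding c using w_square w_carrier by (intro inv_equality) (auto simp: pauli_group_simps)
      then show ?thesis using that by simp
    qed
    show "P \<otimes>\<^bsub>?G\<^esub> Q \<in> range w" if "P \<in> range w" "Q \<in> range w" for P Q
      using that by (auto simp: pauli_group_simps w_mult)
  qed
  have "P \<in> pauli_ops n \<union> uminus ` pauli_ops n" if "P \<in> range w" for P
  proof -
    obtain e x' z' where "e \<in> {1, - 1}" "P = e \<cdot>\<^sub>m pauli n x' z'"
      using \<open>P \<in> range w\<close> w_pauli by blast
    then show ?thesis using pauli_in_pauli_ops[of n x' z'] by (auto simp: uminus_mat_eq_smult)
  qed
  moreover have "- 1\<^sub>m ?d \<noteq> w c" for c
  proof
    assume eq: "- 1\<^sub>m ?d = w c"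
    then have "w c = 1\<^sub>m ?d" using indep[of c "- 1"] w_zero by (simp add: uminus_mat_eq_smult)
    then have "(1\<^sub>m ?d :: complex mat) $$ (0, 0) = (- 1\<^sub>m ?d) $$ (0, 0)" using eq by simp
    then show False by simp
  qed
  ultimately show "abelian_pauli_subgroup n (range w)"
    unfolding abelian_pauli_subgroup_def using sub by (auto simp: w_mult add.commute)
  define h where "h c = w (\<lambda>i. of_int (c i))" for c
  have "h \<in> iso (Z2_power m) (?G\<lparr>carrier := range w\<rparr>)"
  proof (rule isoI)
    have "of_int ((c i + c' i) mod 2) = (of_int (c i) + of_int (c' i) :: bit)" for c c' :: "nat \<Rightarrow> int" and i
      by (simp add: of_int_bit_mod_2)
    then have "h (c \<otimes>\<^bsub>Z2_power m\<^esub> c') = h c * h c'" for c c'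
      unfolding h_def w_mult
      by (auto simp: w_def Z2_power_def product_group_def integer_mod_group_def intro!: word_cong)
    then show "h \<in> hom (Z2_power m) (?G\<lparr>carrier := range w\<rparr>)"
      by (auto simp: hom_def h_def pauli_group_simps)
    have "inj_on h (carrier (Z2_power m))"
    proof (rule inj_onI)
      fix c c' assume c: "c \<in> carrier (Z2_power m)" "c' \<in> carrier (Z2_power m)" "h c = h c'"
      \<comment> \<open>If two words agree, the word of the sum of their exponents is a square,
        hence the identity.\<close>
      then have "w (\<lambda>i. of_int (c i) + of_int (c' i)) = 1 \<cdot>\<^sub>m 1\<^sub>m ?d"
        using w_square by (simp add: h_def flip: w_mult)
      then have eq: "of_int (c i) + of_int (c' i) = (0 :: bit)" if "i < m" for i
        using that by (rule indep)
      show "c = c'"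
      proof (rule PiE_ext)
        fix i assume i: "i \<in> {..<m}"
        then have "c i \<in> {0, 1}" "c' i \<in> {0, 1}" using c by (auto simp: Z2_power_carrier PiE_mem)
        then show "c i = c' i" using eq[of i] i by auto
      qed (use c in \<open>auto simp: Z2_power_carrier\<close>)
    qed
    moreover have "h ` carrier (Z2_power m) = range w"
    proof
      show "range w \<subseteq> h ` carrier (Z2_power m)"
      proof
        fix P assume "P \<in> range w"
        then obtain c where c: "P = w c" by blast
        let ?c = "\<lambda>i\<in>{..<m}. if c i = 0 then 0 else 1 :: int"
        have "of_int (?c i) = c i" if "i < m" for i
          using that by (cases "c i") auto
        then have "h ?c = w c" unfolding h_def w_def by (intro word_cong) simp
        moreover have "?c \<in> carrier (Z2_power m)" by (auto simp: Z2_power_carrier)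
        ultimately show "P \<in> h ` carrier (Z2_power m)" using c by force
      qed
    qed (auto simp: h_def)
    ultimately show "bij_betw h (carrier (Z2_power m)) (carrier (?G\<lparr>carrier := range w\<rparr>))"
      by (simp add: bij_betw_def)
  qed
  then have "Z2_power m \<cong> ?G\<lparr>carrier := range w\<rparr>" by (rule is_isoI)
  then show "has_dimension n (range w) m"
    unfolding has_dimension_def by (rule group.iso_sym[OF group_Z2_power])
qed

section \<open>The groups attached to the points of the unit circle\<close>

theorem corollary3:
  fixes n :: nat
  assumes "n \<ge> 1"
  shows "\<exists>A :: nat \<Rightarrow> complex mat set.
    (\<forall>k \<in> {1..2 ^ n + 1}. abelian_pauli_subgroup n (A k) \<and> has_dimension n (A k) (n - 1)) \<and>
    (\<forall>k \<in> {1..2 ^ n + 1}. \<forall>l \<in> {1..2 ^ n + 1}. k \<noteq> l \<longrightarrow> complementary n (A k) (A l))"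
proof -
  define m where "m = n - 1"
  obtain d where d: "d \<in> gf n" "gf_tr n d = 1" by (rule gf_tr_surj[OF assms])
  obtain u where u: "u ` {1..2 ^ n + 1} \<subseteq> gf_circle n d" "inj_on u {1..2 ^ n + 1 :: nat}"
    by (rule gf_circle_param[OF assms d])
  obtain e where "bit_basis n e (gf n)"
    using bit_basis_exists[OF gf_0 gf_add card_gf[OF assms]] by blast
  then have e: "\<And>i. i < n \<Longrightarrow> e i \<in> gf n"
    and e_span: "\<And>a. a \<in> gf n \<Longrightarrow> \<exists>c. a = (\<Sum>i<n. to_ac (c i) * e i)"
    by (simp_all add: bit_basis_def)
  let ?H = "{a \<in> gf n. gf_tr n a = 0}"
  have ker: "0 \<in> ?H" "\<And>a b. a \<in> ?H \<Longrightarrow> b \<in> ?H \<Longrightarrow> a + b \<in> ?H" "card ?H = 2 ^ m"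
    using card_gf_tr_kernel[OF assms] by (simp_all add: gf_0 gf_add gf_tr_add m_def)
  obtain h where "bit_basis m h ?H" using bit_basis_exists[OF ker] by blast
  then have h: "\<And>i. i < m \<Longrightarrow> h i \<in> ?H"
    and h_span: "\<And>a. a \<in> ?H \<Longrightarrow> \<exists>c. a = (\<Sum>i<m. to_ac (c i) * h i)"
    and h_indep: "\<And>c i. (\<Sum>i<m. to_ac (c i) * h i) = 0 \<Longrightarrow> i < m \<Longrightarrow> c i = 0"
    unfolding bit_basis_def by blast+
  \<comment> \<open>\<open>x\<close> takes coordinates in the basis \<open>e\<close>, and
    \<open>z\<close> those in its trace-dual basis; the plain dot product of the two then is the
    trace form.\<close>
  define x where "x a = (SOME c. a = (\<Sum>i<n. to_ac (c i) * e i))" for a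
  define z where "z a i = gf_tr n (a * e i)" for a i
  have pairing: "(\<Sum>i<n. x a i * z b i) = gf_tr n (a * b)" if a: "a \<in> gf n" and b: "b \<in> gf n" for a b
  proof -
    have "a = (\<Sum>i<n. to_ac (x a i) * e i)"
      unfolding x_def by (rule someI_ex[OF e_span[OF a]])
    then have "a * b = (\<Sum>i<n. to_ac (x a i) * e i) * b" by (rule arg_cong)
    also have "\<dots> = (\<Sum>i<n. to_ac (x a i) * (b * e i))"
      by (simp add: sum_distrib_right mult.assoc mult.commute[of b])
    also have "gf_tr n \<dots> = (\<Sum>i<n. x a i * z b i)"
      using b e by (subst gf_tr_sum) (auto simp: gf_mult gf_to_ac gf_tr_scale z_def)
    finally show ?thesis ..
  qed
  \<comment> \<open>Generator \<open>i\<close> of group \<open>k\<close> is labelled by the field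
    elements s h_i and t h_i, where (s, t) is the circle point \<open>u k\<close> and
    \<open>h\<close> the basis of the trace zero elements.\<close>
  define xl where "xl k i = x (fst (u k) * h i)" for k i
  define zl where "zl k i = z (snd (u k) * h i)" for k i
  define T where "T k l = fst (u k) * snd (u l) + snd (u k) * fst (u l)" for k l
  define w where "w k = word (2 ^ n) (\<lambda>i. pauli n (xl k i) (zl k i)) m" for k
  define vec where "vec c = (\<Sum>i<m. to_ac (c i) * h i)" for c
  let ?I = "{1..2 ^ n + 1 :: nat}"
  have u_gf: "fst (u k) \<in> gf n" "snd (u k) \<in> gf n" if "k \<in> ?I" for k
  proof -
    have "u k \<in> gf_circle n d" using u(1) that by blast
    then show "fst (u k) \<in> gf n" "snd (u k) \<in> gf n" by (auto simp: gf_circle_def)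
  qed
  have form: "label_form n (xl k i) (zl k i) (xl l j) (zl l j) = gf_tr n (T k l * (h i * h j))"
    if "k \<in> ?I" "l \<in> ?I" "i < m" "j < m" for k l i j
  proof -
    have hij: "h i \<in> gf n" "h j \<in> gf n" using h that by auto
    have "label_form n (xl k i) (zl k i) (xl l j) (zl l j)
      = (\<Sum>p<n. x (fst (u k) * h i) p * z (snd (u l) * h j) p)
      + (\<Sum>p<n. x (fst (u l) * h j) p * z (snd (u k) * h i) p)"
      by (simp add: label_form_def xl_def zl_def sum.distrib mult.commute)
    also have "\<dots> = gf_tr n (fst (u k) * h i * (snd (u l) * h j)) + gf_tr n (fst (u l) * h j * (snd (u k) * h i))"
      using u_gf that hij by (simp add: pairing gf_mult)
    also have "\<dots> = gf_tr n (fst (u k) * h i * (snd (u l) * h j) + fst (u l) * h j * (snd (u k) * h i))"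
      using u_gf that hij by (intro gf_tr_add[symmetric] gf_mult)
    also have "\<dots> = gf_tr n (T k l * (h i * h j))"
      by (simp add: T_def algebra_simps)
    finally show ?thesis .
  qed
  \<comment> \<open>Words represent the trace zero elements \<open>vec c\<close>; commutation
    between groups \<open>k\<close> and \<open>l\<close> is the trace form twisted by
    \<open>T k l\<close>.\<close>
  have w_commute: "w k c * w l c' = bit_sign (gf_tr n (T k l * (vec c * vec c'))) \<cdot>\<^sub>m (w l c' * w k c)"
    if k: "k \<in> ?I" and l: "l \<in> ?I" for k l c c'
  proof -
    have T: "T k l \<in> gf n" using u_gf k l by (simp add: T_def gf_add gf_mult)
    have "T k l * (vec c * vec c') = (\<Sum>i<m. \<Sum>j<m. to_ac (c i * c' j) * (T k l * (h i * h j)))"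
      by (simp add: vec_def sum_product sum_distrib_left ac_simps)
    also have "gf_tr n \<dots> = (\<Sum>i<m. \<Sum>j<m. c i * c' j * gf_tr n (T k l * (h i * h j)))"
    proof -
      have 1: "T k l * (h i * h j) \<in> gf n" if "i < m" "j < m" for i j
        using T h that by (intro gf_mult) auto
      have "gf_tr n (\<Sum>i<m. \<Sum>j<m. to_ac (c i * c' j) * (T k l * (h i * h j)))
        = (\<Sum>i<m. gf_tr n (\<Sum>j<m. to_ac (c i * c' j) * (T k l * (h i * h j))))"
        by (intro gf_tr_sum gf_sum gf_mult[OF gf_to_ac] 1) simp_all
      also have "\<dots> = (\<Sum>i<m. \<Sum>j<m. gf_tr n (to_ac (c i * c' j) * (T k l * (h i * h j))))"
        by (intro sum.cong refl gf_tr_sum gf_mult[OF gf_to_ac] 1) simp_all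
      also have "\<dots> = (\<Sum>i<m. \<Sum>j<m. c i * c' j * gf_tr n (T k l * (h i * h j)))"
        by (intro sum.cong refl gf_tr_scale 1) simp_all
      finally show ?thesis .
    qed
    also have "\<dots> = (\<Sum>i<m. \<Sum>j<m. c i * c' j * label_form n (xl k i) (zl k i) (xl l j) (zl l j))"
      using k l by (simp add: form)
    finally show ?thesis unfolding w_def by (subst word_pauli_commute) simp
  qed
  \<comment> \<open>The two summands of \<open>T k k\<close> agree and cancel in characteristic two,
    so each group has isotropic labels.\<close>
  have iso: "label_form n (xl k i) (zl k i) (xl k j) (zl k j) = 0" if "k \<in> ?I" "i < m" "j < m" for k i j
    using form[OF that(1) that] by (simp add: T_def mult.commute)
  have w_square: "w k c * w k c = 1\<^sub>m (2 ^ n)" if "k \<in> ?I" for k c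
    unfolding w_def by (rule word_pauli_mult(2)[OF iso[OF that]])
  have w_carrier: "w k c \<in> carrier_mat (2 ^ n) (2 ^ n)" for k c
    unfolding w_def by (rule word_carrier) simp
  \<comment> \<open>A nonzero coordinate makes \<open>vec c\<close> nonzero. The pairing lemma then
    yields a trace zero partner \<open>b\<close>, whose coordinates define an anticommuting word of
    group \<open>l\<close>.\<close>
  have noncomm: "\<exists>c'. w k c * w l c' \<noteq> w l c' * w k c"
    if k: "k \<in> ?I" and l: "l \<in> ?I" and ne: "k \<noteq> l" and c: "i < m" "c i \<noteq> 0" for k l c i
  proof -
    have "u k \<noteq> u l" using u(2) k l ne by (simp add: inj_on_eq_iff)
    moreover have "(fst (u k), snd (u k)) \<in> gf_circle n d" "(fst (u l), snd (u l)) \<in> gf_circle n d"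
      using u(1) k l by auto
    ultimately have T: "T k l \<in> gf n" "T k l \<noteq> 0" "gf_tr n (1 / T k l) = 1"
      unfolding T_def using gf_circle_distinct[OF d, of "fst (u k)" "snd (u k)" "fst (u l)" "snd (u l)"]
      by (auto simp: prod_eq_iff)
    have "vec c \<in> gf n" using h by (auto simp: vec_def intro!: gf_sum gf_mult gf_to_ac)
    moreover have "gf_tr n (vec c) = 0"
      unfolding vec_def using h by (subst gf_tr_sum) (auto simp: gf_mult gf_to_ac gf_tr_scale)
    moreover have "vec c \<noteq> 0" using h_indep[of c i] c by (auto simp: vec_def)
    ultimately obtain b where b: "b \<in> gf n" "gf_tr n b = 0" "gf_tr n (vec c * b * T k l) = 1"
      by (rule gf_tr_pairing_nondegenerate[OF assms T])
    then obtain c' where "b = vec c'" using h_span[of b] by (auto simp: vec_def)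
    then have "w k c * w l c' = (- 1) \<cdot>\<^sub>m (w l c' * w k c)"
      using b(3) by (simp add: w_commute[OF k l] mult.commute)
    then have "w k c * w l c' \<noteq> w l c' * w k c"
      by (intro not_commute_if_anticommute[of "2 ^ n"] w_carrier w_square k l) simp_all
    then show ?thesis by blast
  qed
  \<comment> \<open>Scalar words commute with everything, whereas a word with a nonzero exponent
    fails to commute with some word of another group. So independence within a group comes from its
    pairing with a second one.\<close>
  have indep: "c i = 0" if k: "k \<in> ?I" and c: "w k c = e \<cdot>\<^sub>m 1\<^sub>m (2 ^ n)" and i: "i < m" for k c e i
  proof (rule ccontr)
    assume "c i \<noteq> 0"
    \<comment> \<open>Any other index serves; 1 and 2 both belong to \<open>?I\<close>.\<close>
    define l :: nat where "l = (if k = 1 then 2 else 1)"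
    have "l \<in> ?I" "k \<noteq> l" by (auto simp: l_def)
    then obtain c' where "w k c * w l c' \<noteq> w l c' * w k c"
      using noncomm[where k = k and l = l and c = c, OF k _ _ i] \<open>c i \<noteq> 0\<close> by blast
    moreover have "w k c * w l c' = w l c' * w k c"
      unfolding c using w_carrier[of l c']
      by (simp add: mult_smult_assoc_mat[of _ "2 ^ n" "2 ^ n" _ "2 ^ n"]
          mult_smult_distrib[of _ "2 ^ n" "2 ^ n" _ "2 ^ n"])
    ultimately show False by blast
  qed
  have sub: "abelian_pauli_subgroup n (range (w k))" "has_dimension n (range (w k)) (n - 1)" if "k \<in> ?I" for k
    using word_pauli_subgroup[where n = n and m = m and x = "xl k" and z = "zl k"] iso[OF that] indep[OF that]
    unfolding w_def m_def by blast+
  have noncomm': "\<exists>P\<in>range (w k). P * Q \<noteq> Q * P"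
    if "k \<in> ?I" "l \<in> ?I" "k \<noteq> l" "Q \<in> range (w l)" "Q \<noteq> 1\<^sub>m (2 ^ n)" for k l Q
  proof -
    obtain c where Q: "Q = w l c" using \<open>Q \<in> range (w l)\<close> by blast
    then obtain i where "i < m" "c i \<noteq> 0"
      using \<open>Q \<noteq> 1\<^sub>m (2 ^ n)\<close> word_zero[of m c] unfolding w_def by blast
    then obtain c' where "w l c * w k c' \<noteq> w k c' * w l c"
      using noncomm[where k = l and l = k and c = c and i = i] \<open>k \<in> ?I\<close> \<open>l \<in> ?I\<close> \<open>k \<noteq> l\<close> by blast
    then show ?thesis unfolding Q by (metis rangeI)
  qed
  have "complementary n (range (w k)) (range (w l))" if "k \<in> ?I" "l \<in> ?I" "k \<noteq> l" for k l
    by (rule complementaryI[OF sub(1)[OF that(1)] sub(1)[OF that(2)]])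
      (use noncomm'[OF that(1,2)] noncomm'[OF that(2,1)] that(3) in auto)
  with sub show ?thesis by (intro exI[of _ "\<lambda>k. range (w k)"]) blast
qed

end
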